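(* Let $\alpha\in(0,1)$, fix $\gamma\in\Gamma$, and suppose that Assumption B (stated in the context) holds for every $h\in\mathcal{H}$. Let $$\lambda=\left\{E_X[f(g(X,\theta_0)|X,\theta_0,\gamma)\nabla_\theta g(X,\theta_0)]\right\}^{-1},\qquad \bar h^-=\lambda\log(1/\alpha),$$ and suppose $\bar h^-\in\mathcal{H}$. Let $\{\hat h_n^-\}$ be a random sequence such that $\sqrt n(\hat h_n^--\bar h^-)=O_{P_{\theta_0+h/n,\gamma}}(1)$ for every fixed $h\in\mathcal{H}$. Define the test $$\phi_n^-(\hat h_n^-,Y^n,X^n)=\begin{cases}1&\text{if } Y_i>g(X_i,\theta_0+\hat h_n^-/n)\text{ for all } i,\\ 0&\text{if } Y_i\le g(X_i,\theta_0+\hat h_n^-/n)\text{ for some } i.\end{cases}$$ Then $\{\phi_n^-(\hat h_n^-,Y^n,X^n)\}$ is asymptotically uniformly most powerful (AUMP) in $\mathcal{H}$ at asymptotic level $\alpha$ for the nuisance parameter value $\gamma$ when testing $H_0^-:h\le0$ against $H_1^-:h>0$. That is, $\limsup_nE_{\theta_0+h/n,\gamma}[\phi_n^-]\le\alpha$ for every $h\le0$ in $\mathcal{H}$, and for every other sequence of tests $\{\psi_n\}$ satisfying $\limsup_nE_{\theta_0+h/n,\gamma}[\psi_n]\le\alpha$ for every $h\le0$ in $\mathcal{H}$, $$\liminf_nE_{\theta_0+h/n,\gamma}[\phi_n^-]\ \ge\ \limsup_nE_{\theta_0+h/n,\gamma}[\psi_n]\quad\text{for every } h>0\text{ in }\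mathcal{H}.$$
   Context: Model. $(Y,X)$ with $Y$ scalar and $X$ a $d_X$-dimensional vector of discrete covariates with finite support $\mathcal{X}=\{a_1,\ldots,a_L\}$. Conditionally on $X=x$, $Y$ has Lebesgue density $f(y|x,\theta,\gamma)\mathbb{I}\{y\ge g(x,\theta)\}$, where $\theta\in\Theta\subset\mathbb{R}$ is the scalar parameter of interest, $\gamma\in\Gamma\subset\mathbb{R}^d$ is a nuisance parameter, and $\mathbb{I}\{\cdot\}$ is the indicator function. Fix $\theta_0\in\Theta$ and reparametrize $h=n(\theta-\theta_0)\in\mathcal{H}\subset\mathbb{R}$. One observes an i.i.d. sample $(Y^n,X^n)=((Y_1,\ldots,Y_n),(X_1,\ldots,X_n))$. $P_{\theta_0+h/n,\gamma}$ and $E_{\theta_0+h/n,\gamma}$ denote probability and expectation when the sample is drawn from the model with parameters $(\theta_0+h/n,\gamma)$ ($n$ large enough that $\theta_0+h/n\in\Theta$); $E_X$ is expectation over the marginal law of $X$. $O_{P_{\theta_0+h/n,\gamma}}(1)$ means bounded in probability under the sequence $P_{\theta_0+h/n,\gamma}$. A test is a $[0,1]$-valued measurable function of the data, interpreted as the probability of rejecting the null. Expressions such as $g(X_i,\theta_0+\hat h_n/n)$ may be defined arbitrarily on the event (of probability tending to zero) where the plugged-in parameter leaves the parameter space. Assumption B. (i) $\{(Y_i,X_i)\}_{i=1}^n$ is an i.i.d. sample taking values in $\mathcal{Y}\times\mathcal{X}$, $\mathcal{Y}\subset\mathbb{R}$, with $\mathcal{X}=\{a_1,\ldots,a_L\}$,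 and the conditional density of $Y$ given $X=x$ is $f(y|x,\theta,\gamma)\mathbb{I}\{y\ge g(x,\theta)\}$. $\Theta\times\Gamma$ is convex, $\theta_0\in\mathrm{int}(\Theta)$, $\gamma\in\mathrm{int}(\Gamma)$, $0\in\mathcal{H}$. The marginal distribution of $X$ satisfies $\Pr\{X=a_j\}>0$ for each $j=1,\ldots,L$ and does not depend on $(\theta,\gamma)$. (ii) $\{\hat h_n\}$ is a random sequence satisfying $\sqrt n(\hat h_n-\bar h)=O_{P_{\theta_0+h/n,\gamma}}(1)$ for some user-specified constant $\bar h$ (in the claim, $\hat h_n=\hat h_n^-$ and $\bar h=\bar h^-$), and $\{\hat\gamma_n\}$ is a random sequence satisfying $\sqrt n(\hat\gamma_n-\gamma)=O_{P_{\theta_0+h/n,\gamma}}(1)$. (iii) Let $\beta=(\theta,\gamma')'$ and let $\beta_0=(\theta_0,\gamma')'$ with $\gamma$ the fixed true value. $f(y|x,\beta)$ is twice continuously differentiable in $\beta$ for all $y,x$, and $g(x,\theta)$ is continuously differentiable in $\theta$ for all $x$. In some open neighborhood $\mathcal{N}$ of $\beta_0$: $f(y|x,\beta)$ and $\nabla_\beta f(y|x,\beta)$ are continuous in $y$ for $\beta\in\mathcal{N}$; there is a constant $C$ such that $0<f(y|x,\beta)<C<\infty$ and $\|\nabla_\beta f(y|x,\beta)\|<C<\infty$ for all $y,x$ and $\beta\in\mathcal{N}$; and for each $j=1,\ldots,L$, $$\int\sup_{\beta\in\mathcal{N}}\|\nabla_\beta f(y|a_j,\beta)\|\,\mathbb{I}\{y\ge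 g(a_j,\theta)\}\,dy<\infty,$$ $$\int\sup_{\bar\beta,\beta\in\mathcal{N}}\frac{\|\nabla_\beta f(y|a_j,\bar\beta)\|^2}{f(y|a_j,\bar\beta)^2}\mathbb{I}\{y\ge g(a_j,\theta)\}f(y|a_j,\beta)\,dy<\infty,$$ $$\int\sup_{\bar\beta,\beta\in\mathcal{N}}\frac{\|\nabla_{\beta\beta} f(y|a_j,\bar\beta)\|}{f(y|a_j,\bar\beta)}\mathbb{I}\{y\ge g(a_j,\theta)\}f(y|a_j,\beta)\,dy<\infty.$$ $\nabla_\theta g(a_j,\theta_0)>0$ and $\sup_{\beta\in\mathcal{N}}\|\nabla_\theta g(a_j,\theta)\|<\infty$ for each $j=1,\ldots,L$. *)

theory Defs
  imports "HOL-Probability.Probability"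
begin

text \<open>
  A parametric model for a scalar outcome \<open>Y\<close> given finitely supported covariates \<open>X\<close>, with a
  parameter-dependent lower support point. Full parameters are pairs \<open>\<beta> = (\<theta>, \<gamma>)\<close>.
\<close>

record ('x, 'g) boundary_model =
  Theta_set :: "real set"
  Gamma_set :: "'g set"
  Yset  :: "real set"
  Xset  :: "'x set"
  px    :: "'x \<Rightarrow> real"
  dens  :: "real \<Rightarrow> 'x \<Rightarrow> real \<times> 'g \<Rightarrow> real"  \<comment> \<open>\<open>f(y|x,\<beta>)\<close>, without the support indicator\<close>
  bdry  :: "'x \<Rightarrow> real \<Rightarrow> real"  \<comment> \<open>\<open>g(x,\<theta>)\<close>\<close>

definition X_law :: "('x, 'g) boundary_model \<Rightarrow> 'x measure" where
  "X_law m = point_measure (Xset m) (\<lambda>x. ennreal (px m x))"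

definition supp :: "('x, 'g) boundary_model \<Rightarrow> 'x \<Rightarrow> real \<Rightarrow> real set" where
  "supp m x \<theta> = {y \<in> Yset m. bdry m x \<theta> \<le> y}"

definition obs_law :: "('x, 'g) boundary_model \<Rightarrow> real \<times> 'g \<Rightarrow> (real \<times> 'x) measure" where
  "obs_law m \<beta> = density (lborel \<Otimes>\<^sub>M X_law m)
     (\<lambda>(y, x). ennreal (dens m y x \<beta>) * indicator (supp m x (fst \<beta>)) y)"

text \<open>A sample of size \<open>n\<close> is a function \<open>z\<close> on \<open>{..<n}\<close> with \<open>z i = (Y\<^sub>i, X\<^sub>i)\<close>.\<close>

definition sample_law ::
  "('x, 'g) boundary_model \<Rightarrow> nat \<Rightarrow> real \<times> 'g \<Rightarrow> (nat \<Rightarrow> real \<times> 'x) measure" where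
  "sample_law m n \<beta> = (\<Pi>\<^sub>M i\<in>{..<n}. obs_law m \<beta>)"

definition sample_space :: "('x, 'g) boundary_model \<Rightarrow> nat \<Rightarrow> (nat \<Rightarrow> real \<times> 'x) measure" where
  "sample_space m n = (\<Pi>\<^sub>M i\<in>{..<n}. borel \<Otimes>\<^sub>M count_space (Xset m))"

text \<open>The law under the local parameter \<open>h\<close>. It is only meaningful when \<open>\<theta>\<^sub>0 + h/n\<close> lies in the
  parameter set, i.e. for large \<open>n\<close>; all uses below are asymptotic.\<close>

definition local_law ::
  "('x, 'g) boundary_model \<Rightarrow> real \<Rightarrow> 'g \<Rightarrow> real \<Rightarrow> nat \<Rightarrow> (nat \<Rightarrow> real \<times> 'x) measure" where
  "local_law m \<theta>\<^sub>0 \<gamma> h n = sample_law m n (\<theta>\<^sub>0 + h / real n, \<gamma>)"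

definition bounded_in_prob ::
  "(nat \<Rightarrow> 'a measure) \<Rightarrow> (nat \<Rightarrow> 'a \<Rightarrow> 'b::real_normed_vector) \<Rightarrow> bool" where
  "bounded_in_prob P Z \<longleftrightarrow>
     (\<forall>\<epsilon>>0. \<exists>K. \<forall>\<^sub>F n in sequentially. measure (P n) {z \<in> space (P n). norm (Z n z) > K} < \<epsilon>)"

definition is_test :: "('x, 'g) boundary_model \<Rightarrow> nat \<Rightarrow> ((nat \<Rightarrow> real \<times> 'x) \<Rightarrow> real) \<Rightarrow> bool" where
  "is_test m n \<phi> \<longleftrightarrow> \<phi> \<in> borel_measurable (sample_space m n) \<and>
     (\<forall>z \<in> space (sample_space m n). 0 \<le> \<phi> z \<and> \<phi> z \<le> 1)"

definition rejection_prob ::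
  "('x, 'g) boundary_model \<Rightarrow> real \<Rightarrow> 'g \<Rightarrow> (nat \<Rightarrow> (nat \<Rightarrow> real \<times> 'x) \<Rightarrow> real) \<Rightarrow> real \<Rightarrow> nat \<Rightarrow> ereal"
  where
  "rejection_prob m \<theta>\<^sub>0 \<gamma> \<phi> h n = ereal (\<integral>z. \<phi> n z \<partial>local_law m \<theta>\<^sub>0 \<gamma> h n)"

definition asymp_level ::
  "('x, 'g) boundary_model \<Rightarrow> real \<Rightarrow> 'g \<Rightarrow> real \<Rightarrow> real set \<Rightarrow>
     (nat \<Rightarrow> (nat \<Rightarrow> real \<times> 'x) \<Rightarrow> real) \<Rightarrow> bool" where
  "asymp_level m \<theta>\<^sub>0 \<gamma> \<alpha> H0 \<phi> \<longleftrightarrow> (\<forall>n. is_test m n (\<phi> n)) \<and>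
     (\<forall>h\<in>H0. limsup (rejection_prob m \<theta>\<^sub>0 \<gamma> \<phi> h) \<le> ereal \<alpha>)"

definition AUMP ::
  "('x, 'g) boundary_model \<Rightarrow> real \<Rightarrow> 'g \<Rightarrow> real \<Rightarrow> real set \<Rightarrow> real set \<Rightarrow>
     (nat \<Rightarrow> (nat \<Rightarrow> real \<times> 'x) \<Rightarrow> real) \<Rightarrow> bool" where
  "AUMP m \<theta>\<^sub>0 \<gamma> \<alpha> H0 H1 \<phi> \<longleftrightarrow> asymp_level m \<theta>\<^sub>0 \<gamma> \<alpha> H0 \<phi> \<and>
     (\<forall>\<psi>. asymp_level m \<theta>\<^sub>0 \<gamma> \<alpha> H0 \<psi> \<longrightarrow>
        (\<forall>h\<in>H1. limsup (rejection_prob m \<theta>\<^sub>0 \<gamma> \<psi> h) \<le> liminf (rejection_prob m \<theta>\<^sub>0 \<gamma> \<phi> h)))"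

text \<open>
  The interior condition on \<open>Yset\<close> makes explicit that \<open>f\<close> is defined, and its continuity in \<open>y\<close>
  meaningful, around the boundary points; it is void when \<open>Yset\<close> is the whole line.
\<close>

definition assumption_B_i ::
  "('x::euclidean_space, 'g::euclidean_space) boundary_model \<Rightarrow> real set \<Rightarrow> real \<Rightarrow> 'g \<Rightarrow> bool" where
  "assumption_B_i m H \<theta>\<^sub>0 \<gamma> \<longleftrightarrow>
     finite (Xset m) \<and> (\<forall>a\<in>Xset m. px m a > 0) \<and> (\<Sum>a\<in>Xset m. px m a) = 1 \<and>
     Yset m \<in> sets borel \<and> (\<forall>a\<in>Xset m. bdry m a \<theta>\<^sub>0 \<in> interior (Yset m)) \<and>
     (\<forall>\<beta>\<in>Theta_set m \<times> Gamma_set m. \<forall>a\<in>Xset m.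
        set_borel_measurable borel (supp m a (fst \<beta>)) (\<lambda>y. dens m y a \<beta>) \<and>
        (\<forall>y\<in>supp m a (fst \<beta>). 0 \<le> dens m y a \<beta>) \<and>
        (\<integral>\<^sup>+y\<in>supp m a (fst \<beta>). ennreal (dens m y a \<beta>) \<partial>lborel) = 1) \<and>
     convex (Theta_set m \<times> Gamma_set m) \<and> \<theta>\<^sub>0 \<in> interior (Theta_set m) \<and> \<gamma> \<in> interior (Gamma_set m) \<and> 0 \<in> H"

definition assumption_B_ii ::
  "('x::euclidean_space, 'g::euclidean_space) boundary_model \<Rightarrow> real \<Rightarrow> 'g \<Rightarrow>
     (nat \<Rightarrow> (nat \<Rightarrow> real \<times> 'x) \<Rightarrow> real) \<Rightarrow> real \<Rightarrow> (nat \<Rightarrow> (nat \<Rightarrow> real \<times> 'x) \<Rightarrow> 'g) \<Rightarrow> real \<Rightarrow> bool" where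
  "assumption_B_ii m \<theta>\<^sub>0 \<gamma> hhat hbar ghat h \<longleftrightarrow>
     (\<forall>n. hhat n \<in> borel_measurable (sample_space m n)) \<and>
     (\<forall>n. ghat n \<in> borel_measurable (sample_space m n)) \<and>
     bounded_in_prob (local_law m \<theta>\<^sub>0 \<gamma> h) (\<lambda>n z. sqrt (real n) * (hhat n z - hbar)) \<and>
     bounded_in_prob (local_law m \<theta>\<^sub>0 \<gamma> h) (\<lambda>n z. sqrt (real n) *\<^sub>R (ghat n z - \<gamma>))"

text \<open>
  Here \<open>f'\<close>, \<open>f''\<close> are the gradient and the Hessian of \<open>f\<close> in \<open>\<beta>\<close>, and \<open>g'\<close> the derivative of \<open>g\<close>
  in \<open>\<theta>\<close>. Derivatives are taken within the parameter set, which is convex with nonempty interior,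
  so they are unique. The Hessian is a bounded linear map with the operator norm; the choice of
  norm does not affect the integrability condition. Inside each supremum the \<open>\<theta>\<close> in the support
  indicator is the first component of the \<open>\<beta>\<close> over which the supremum runs.
\<close>

definition assumption_B_iii ::
  "('x::euclidean_space, 'g::euclidean_space) boundary_model \<Rightarrow>
     (real \<Rightarrow> 'x \<Rightarrow> real \<times> 'g \<Rightarrow> real \<times> 'g) \<Rightarrow>
     (real \<Rightarrow> 'x \<Rightarrow> real \<times> 'g \<Rightarrow> (real \<times> 'g) \<Rightarrow>\<^sub>L (real \<times> 'g)) \<Rightarrow>
     ('x \<Rightarrow> real \<Rightarrow> real) \<Rightarrow> real \<Rightarrow> 'g \<Rightarrow> bool" where
  "assumption_B_iii m f' f'' g' \<theta>\<^sub>0 \<gamma> \<longleftrightarrow>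
     (\<forall>y\<in>Yset m. \<forall>a\<in>Xset m.
        (\<forall>\<beta>\<in>Theta_set m \<times> Gamma_set m.
           (dens m y a has_derivative (\<lambda>v. f' y a \<beta> \<bullet> v)) (at \<beta> within Theta_set m \<times> Gamma_set m) \<and>
           (f' y a has_derivative blinfun_apply (f'' y a \<beta>)) (at \<beta> within Theta_set m \<times> Gamma_set m)) \<and>
        continuous_on (Theta_set m \<times> Gamma_set m) (f'' y a)) \<and>
     (\<forall>a\<in>Xset m.
        (\<forall>\<theta>\<in>Theta_set m. (bdry m a has_real_derivative g' a \<theta>) (at \<theta> within Theta_set m)) \<and>
        continuous_on (Theta_set m) (g' a)) \<and>
     (\<exists>N C. open N \<and> (\<theta>\<^sub>0, \<gamma>) \<in> N \<and> N \<subseteq> Theta_set m \<times> Gamma_set m \<and>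
        (\<forall>\<beta>\<in>N. \<forall>a\<in>Xset m.
           continuous_on (Yset m) (\<lambda>y. dens m y a \<beta>) \<and>
           continuous_on (Yset m) (\<lambda>y. f' y a \<beta>) \<and>
           (\<forall>y\<in>Yset m. 0 < dens m y a \<beta> \<and> dens m y a \<beta> < C \<and> norm (f' y a \<beta>) < C)) \<and>
        (\<forall>a\<in>Xset m.
           (\<integral>\<^sup>+y\<in>Yset m. (SUP \<beta>\<in>N. ennreal
               (norm (f' y a \<beta>) * indicator {bdry m a (fst \<beta>)..} y)) \<partial>lborel) < \<infinity> \<and>
           (\<integral>\<^sup>+y\<in>Yset m. (SUP (\<beta>', \<beta>)\<in>N \<times> N. ennreal
               ((norm (f' y a \<beta>'))\<^sup>2 / (dens m y a \<beta>')\<^sup>2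
                 * indicator {bdry m a (fst \<beta>)..} y * dens m y a \<beta>)) \<partial>lborel) < \<infinity> \<and>
           (\<integral>\<^sup>+y\<in>Yset m. (SUP (\<beta>', \<beta>)\<in>N \<times> N. ennreal
               (norm (f'' y a \<beta>') / dens m y a \<beta>'
                 * indicator {bdry m a (fst \<beta>)..} y * dens m y a \<beta>)) \<partial>lborel) < \<infinity> \<and>
           g' a \<theta>\<^sub>0 > 0 \<and>
           bdd_above ((\<lambda>\<beta>. \<bar>g' a (fst \<beta>)\<bar>) ` N)))"

definition assumption_B ::
  "('x::euclidean_space, 'g::euclidean_space) boundary_model \<Rightarrow>
     (real \<Rightarrow> 'x \<Rightarrow> real \<times> 'g \<Rightarrow> real \<times> 'g) \<Rightarrow>
     (real \<Rightarrow> 'x \<Rightarrow> real \<times> 'g \<Rightarrow> (real \<times> 'g) \<Rightarrow>\<^sub>L (real \<times> 'g)) \<Rightarrow>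
     ('x \<Rightarrow> real \<Rightarrow> real) \<Rightarrow> real set \<Rightarrow> real \<Rightarrow> 'g \<Rightarrow>
     (nat \<Rightarrow> (nat \<Rightarrow> real \<times> 'x) \<Rightarrow> real) \<Rightarrow> real \<Rightarrow> (nat \<Rightarrow> (nat \<Rightarrow> real \<times> 'x) \<Rightarrow> 'g) \<Rightarrow> real \<Rightarrow> bool" where
  "assumption_B m f' f'' g' H \<theta>\<^sub>0 \<gamma> hhat hbar ghat h \<longleftrightarrow>
     assumption_B_i m H \<theta>\<^sub>0 \<gamma> \<and>
     assumption_B_ii m \<theta>\<^sub>0 \<gamma> hhat hbar ghat h \<and>
     assumption_B_iii m f' f'' g' \<theta>\<^sub>0 \<gamma>"

text \<open>
  On the event that the plugged-in parameter leaves \<open>Theta_set\<close>, where \<open>g\<close> is not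
  defined, the test takes the value of an arbitrary auxiliary function \<open>dflt\<close>.
\<close>

definition phi_minus ::
  "('x, 'g) boundary_model \<Rightarrow> real \<Rightarrow> (nat \<Rightarrow> (nat \<Rightarrow> real \<times> 'x) \<Rightarrow> real) \<Rightarrow>
     (nat \<Rightarrow> (nat \<Rightarrow> real \<times> 'x) \<Rightarrow> real) \<Rightarrow> nat \<Rightarrow> (nat \<Rightarrow> real \<times> 'x) \<Rightarrow> real" where
  "phi_minus m \<theta>\<^sub>0 dflt hhat n z =
     (let \<theta> = \<theta>\<^sub>0 + hhat n z / real n in
      if \<theta> \<in> Theta_set m
      then (if \<forall>i<n. fst (z i) > bdry m (snd (z i)) \<theta> then 1 else 0)
      else dflt n z)"

end

theory Submission
  imports Defs
begin

text \<open>
  The argument rests on two asymptotic facts about samples drawn at \<open>\<theta>\<^sub>0 + h/n\<close>, governed by one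
  number, the boundary intensity \<open>rate = E\<^sub>X[f(g(X,\<theta>\<^sub>0)|X,\<theta>\<^sub>0,\<gamma>) \<nabla>g(X,\<theta>\<^sub>0)]\<close>, the inverse of
  \<open>\<lambda>\<close>.
  
  Power of the test. One observation falls between the boundaries of parameters \<open>h\<close> and \<open>k \<ge> h\<close> with
  probability \<open>rate * (k - h) / n + o(1/n)\<close>, because the density is continuous at the boundary. So
  the whole sample stays above the boundary of parameter \<open>k\<close> with probability tending to
  \<open>exp (- rate * max 0 (k - h))\<close> (\<open>prob_all_above_limit\<close>). The boundaries increase in the parameter,
  so replacing \<open>k\<close> by an estimator converging to \<open>hbar\<close> does not move the limit: the test lies between
  the corresponding events for \<open>hbar - \<delta>\<close> and \<open>hbar + 2 * \<delta>\<close>, off an event of vanishing probability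
  (\<open>phi_minus_power\<close>). As \<open>rate * hbar = ln (1 / \<alpha>)\<close>, the limit is \<open>min 1 (\<alpha> * exp (rate * h))\<close>.
  
  Power of a competitor. For \<open>h > 0\<close> the likelihood ratio of \<open>n\<close> observations at \<open>\<theta>\<^sub>0 + h/n\<close> against
  \<open>\<theta>\<^sub>0\<close> is asymptotically \<open>c = exp (rate * h)\<close> times the indicator \<open>J\<close> that the whole sample lies above
  the larger boundary. It is enough to know this in Hellinger distance, where it reduces to one
  observation: for the ratio \<open>R = \<Prod>r(z\<^sub>i)\<close> the expectation of \<open>(sqrt R - sqrt c * J)\<^sup>2\<close> under \<open>\<theta>\<^sub>0\<close>
  equals \<open>1 + c * A^n - 2 * sqrt c * b^n\<close>, where \<open>A\<close> is the probability of a single point lying above and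
  \<open>b = E[sqrt r] = (1 + A - H)/2\<close> with \<open>H = E(sqrt r - 1)\<^sup>2\<close> restricted to that event. The score
  integrability condition gives \<open>H = O(1/n\<^sup>2)\<close> (\<open>hellinger_bound\<close>), hence \<open>A^n \<rightarrow> 1/c\<close>,
  \<open>b^n \<rightarrow> 1 / sqrt c\<close> and the expectation tends to 0. So the power at \<open>h\<close> of any test of asymptotic
  size at most \<open>\<alpha>\<close> at \<open>h = 0\<close> is asymptotically at most \<open>c * \<alpha>\<close> (\<open>power_envelope\<close>), and trivially at
  most 1. This is the Neyman-Pearson bound, and the test attains it for every \<open>h > 0\<close>.
\<close>

section \<open>Limits\<close>

lemma tendsto_power_exp:
  fixes x :: "nat \<Rightarrow> real"
  assumes "(\<lambda>n. real n * (1 - x n)) \<longlonglongrightarrow> l"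
  shows "(\<lambda>n. x n ^ n) \<longlonglongrightarrow> exp (- l)"
proof -
  define t where "t n = x n - 1" for n
  have nt: "(\<lambda>n. real n * t n) \<longlonglongrightarrow> - l"
    using tendsto_minus[OF assms] by (simp add: t_def algebra_simps)
  have inv: "(\<lambda>n. inverse (real n)) \<longlonglongrightarrow> 0"
    by (rule lim_inverse_n)
  have "(\<lambda>n. (real n * t n) * inverse (real n)) \<longlonglongrightarrow> - l * 0"
    by (intro tendsto_mult nt inv)
  moreover have "\<forall>\<^sub>F n in sequentially. real n * t n * inverse (real n) = t n"
    using eventually_gt_at_top[of 0] by eventually_elim simp
  ultimately have "t \<longlonglongrightarrow> - l * 0" by (rule Lim_transform_eventually)
  then have t0: "t \<longlonglongrightarrow> 0" by simp
  have small: "\<forall>\<^sub>F n in sequentially. \<bar>t n\<bar> < 1/2"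
    using tendstoD[OF t0, of "1/2"] by (simp add: dist_real_def)
  have "(\<lambda>n. 2 * (real n * t n) * t n) \<longlonglongrightarrow> 2 * (- l) * 0"
    by (intro tendsto_intros nt t0)
  then have up: "(\<lambda>n. \<bar>2 * (real n * t n) * t n\<bar>) \<longlonglongrightarrow> 0"
    by (simp add: tendsto_rabs_zero)
  have "(\<lambda>n. real n * ln (1 + t n) - real n * t n) \<longlonglongrightarrow> 0"
  proof (rule Lim_null_comparison[OF _ up])
    show "\<forall>\<^sub>F n in sequentially. norm (real n * ln (1 + t n) - real n * t n) \<le> \<bar>2 * (real n * t n) * t n\<bar>"
      using small
    proof eventually_elim
      case (elim n)
      have "\<bar>ln (1 + t n) - t n\<bar> \<le> 2 * (t n)\<^sup>2"
        using elim by (intro abs_ln_one_plus_x_minus_x_bound) auto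
      then have "real n * \<bar>ln (1 + t n) - t n\<bar> \<le> real n * (2 * (t n)\<^sup>2)"
        by (intro mult_left_mono) auto
      then show ?case
        by (simp add: abs_mult power2_eq_square right_diff_distrib[symmetric] mult_ac)
    qed
  qed
  from tendsto_add[OF this nt] have "(\<lambda>n. real n * ln (1 + t n)) \<longlonglongrightarrow> - l" by simp
  then have "(\<lambda>n. exp (real n * ln (1 + t n))) \<longlonglongrightarrow> exp (- l)"
    by (intro tendsto_exp)
  then show ?thesis
  proof (rule Lim_transform_eventually)
    show "\<forall>\<^sub>F n in sequentially. exp (real n * ln (1 + t n)) = x n ^ n"
      using small
    proof eventually_elim
      case (elim n)
      then have "x n > 0" by (auto simp: t_def abs_if split: if_splits)
      then show ?case by (simp add: t_def exp_of_nat_mult)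
    qed
  qed
qed

lemma bounded_in_prob_deviation:
  fixes Z :: "nat \<Rightarrow> 'a \<Rightarrow> real"
  assumes bd: "bounded_in_prob P (\<lambda>n z. sqrt (real n) * (Z n z - c))"
    and fin: "\<forall>\<^sub>F n in sequentially. finite_measure (P n) \<and> Z n \<in> borel_measurable (P n)"
    and "\<delta> > 0"
  shows "(\<lambda>n. measure (P n) {z \<in> space (P n). \<bar>Z n z - c\<bar> > \<delta>}) \<longlonglongrightarrow> 0"
proof (rule tendstoI)
  fix e :: real assume "e > 0"
  then obtain K where K: "\<forall>\<^sub>F n in sequentially.
      measure (P n) {z \<in> space (P n). norm (sqrt (real n) * (Z n z - c)) > K} < e"
    using bd unfolding bounded_in_prob_def by blast
  have "filterlim (\<lambda>n. \<delta> * sqrt (real n)) at_top sequentially"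
    by (intro filterlim_tendsto_pos_mult_at_top[OF tendsto_const \<open>\<delta> > 0\<close>]
          filterlim_compose[OF sqrt_at_top] filterlim_real_sequentially)
  then have "\<forall>\<^sub>F n in sequentially. K \<le> \<delta> * sqrt (real n)"
    by (simp add: filterlim_at_top)
  with K fin eventually_gt_at_top[of 0]
  show "\<forall>\<^sub>F n in sequentially. dist (measure (P n) {z \<in> space (P n). \<bar>Z n z - c\<bar> > \<delta>}) 0 < e"
  proof eventually_elim
    case (elim n)
    then interpret finite_measure "P n" by simp
    have [measurable]: "Z n \<in> borel_measurable (P n)" using elim by simp
    have "measure (P n) {z \<in> space (P n). \<bar>Z n z - c\<bar> > \<delta>}
        \<le> measure (P n) {z \<in> space (P n). norm (sqrt (real n) * (Z n z - c)) > K}"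
    proof (rule finite_measure_mono)
      show "{z \<in> space (P n). \<bar>Z n z - c\<bar> > \<delta>} \<subseteq> {z \<in> space (P n). norm (sqrt (real n) * (Z n z - c)) > K}"
      proof safe
        fix z assume "\<delta> < \<bar>Z n z - c\<bar>"
        then have "\<delta> * sqrt (real n) < \<bar>Z n z - c\<bar> * sqrt (real n)"
          using elim by (intro mult_strict_right_mono) auto
        then show "K < norm (sqrt (real n) * (Z n z - c))"
          using \<open>K \<le> \<delta> * sqrt (real n)\<close> by (simp add: abs_mult mult.commute[of "sqrt (real n)"])
      qed
    qed measurable
    with elim show ?case by simp
  qed
qed

lemma limsup_ereal_le_iff:
  fixes f :: "nat \<Rightarrow> real"
  shows "limsup (\<lambda>n. ereal (f n)) \<le> ereal a \<longleftrightarrow> (\<forall>e>0. \<forall>\<^sub>F n in sequentially. f n < a + e)"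
proof
  assume *: "limsup (\<lambda>n. ereal (f n)) \<le> ereal a"
  show "\<forall>e>0. \<forall>\<^sub>F n in sequentially. f n < a + e"
  proof (intro allI impI)
    fix e :: real assume "e > 0"
    then have "ereal (a + e) > ereal a" by simp
    with * have "\<forall>\<^sub>F n in sequentially. ereal (f n) < ereal (a + e)"
      unfolding Limsup_le_iff by blast
    then show "\<forall>\<^sub>F n in sequentially. f n < a + e" by simp
  qed
next
  assume *: "\<forall>e>0. \<forall>\<^sub>F n in sequentially. f n < a + e"
  show "limsup (\<lambda>n. ereal (f n)) \<le> ereal a"
    unfolding Limsup_le_iff
  proof (intro allI impI)
    fix y assume "ereal a < y"
    then show "\<forall>\<^sub>F n in sequentially. ereal (f n) < y"
    proof (cases y)
      case (real r)
      with \<open>ereal a < y\<close> have "r - a > 0" by simp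
      with * have "\<forall>\<^sub>F n in sequentially. f n < a + (r - a)" by blast
      then show ?thesis by (simp add: real)
    qed auto
  qed
qed

lemma scaled_difference_quotient:
  fixes f :: "real \<Rightarrow> real"
  assumes "(f has_real_derivative D) (at x)"
  shows "(\<lambda>n. real n * (f (x + k / real n) - f x)) \<longlonglongrightarrow> k * D"
proof (cases "k = 0")
  case False
  have "(\<lambda>n. k / real n) \<longlonglongrightarrow> 0" by (rule lim_const_over_n)
  moreover have "\<forall>\<^sub>F n in sequentially. k / real n \<noteq> 0"
    using eventually_gt_at_top[of 0] by eventually_elim (use False in auto)
  ultimately have "filterlim (\<lambda>n. k / real n) (at 0) sequentially"
    by (simp add: filterlim_at)
  with assms have "(\<lambda>n. (f (x + k / real n) - f x) / (k / real n)) \<longlonglongrightarrow> D"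
    unfolding DERIV_def by (rule filterlim_compose)
  then have "(\<lambda>n. k * ((f (x + k / real n) - f x) / (k / real n))) \<longlonglongrightarrow> k * D"
    by (intro tendsto_intros)
  then show ?thesis using False by (simp add: mult_ac)
qed simp

text \<open>
  Turns a bound relative to the width of a shrinking window into the limit of its rescaled mass.
\<close>

lemma tendsto_mult_of_relative_error:
  fixes x w :: "nat \<Rightarrow> real"
  assumes x: "x \<longlonglongrightarrow> D"
    and w: "\<And>e. e > 0 \<Longrightarrow> \<forall>\<^sub>F n in sequentially. \<bar>w n - L * x n\<bar> \<le> e * x n"
  shows "w \<longlonglongrightarrow> L * D"
proof -
  have "(\<lambda>n. w n - L * x n) \<longlonglongrightarrow> 0"
  proof (rule tendstoI)
    fix e :: real assume e: "e > 0"
    let ?d = "e / (\<bar>D\<bar> + 1)"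
    have d: "?d > 0" using e by simp
    have "\<forall>\<^sub>F n in sequentially. x n < \<bar>D\<bar> + 1"
      using x by (rule order_tendstoD) simp
    with w[OF d] show "\<forall>\<^sub>F n in sequentially. dist (w n - L * x n) 0 < e"
    proof eventually_elim
      case (elim n)
      have "?d * x n < ?d * (\<bar>D\<bar> + 1)" using elim d by (intro mult_strict_left_mono) auto
      also have "\<dots> = e" by (simp add: field_simps)
      finally show ?case using elim by simp
    qed
  qed
  from tendsto_add[OF this tendsto_mult[OF tendsto_const x, of L]] show ?thesis by simp
qed

section \<open>Likelihood ratios of product measures\<close>

text \<open>
  Both sides agree on boxes, where the integral of a product of functions of the coordinates
  factorises.
\<close>

lemma PiM_density:
  fixes r :: "'a \<Rightarrow> ennreal"
  assumes I: "finite I" and M: "sigma_finite_measure M"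
    and D: "sigma_finite_measure (density M r)" and r[measurable]: "r \<in> borel_measurable M"
  shows "PiM I (\<lambda>_. density M r) = density (PiM I (\<lambda>_. M)) (\<lambda>z. \<Prod>i\<in>I. r (z i))"
proof -
  interpret M: product_sigma_finite "\<lambda>_. M" by (rule product_sigma_finite.intro) (rule M)
  interpret D: product_sigma_finite "\<lambda>_. density M r" by (rule product_sigma_finite.intro) (rule D)
  show ?thesis
  proof (rule D.PiM_eqI[symmetric, OF I])
    show "sets (density (Pi\<^sub>M I (\<lambda>_. M)) (\<lambda>z. \<Prod>i\<in>I. r (z i))) = sets (Pi\<^sub>M I (\<lambda>_. density M r))"
      by (simp, intro sets_PiM_cong) auto
    fix A assume "\<And>i. i \<in> I \<Longrightarrow> A i \<in> sets (density M r)"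
    then have A[measurable]: "\<And>i. i \<in> I \<Longrightarrow> A i \<in> sets M" by simp
    have "emeasure (density (Pi\<^sub>M I (\<lambda>_. M)) (\<lambda>z. \<Prod>i\<in>I. r (z i))) (Pi\<^sub>E I A)
        = (\<integral>\<^sup>+z. (\<Prod>i\<in>I. r (z i)) * indicator (Pi\<^sub>E I A) z \<partial>Pi\<^sub>M I (\<lambda>_. M))"
      using I by (intro emeasure_density) (auto intro!: sets_PiM_I_finite A)
    also have "\<dots> = (\<integral>\<^sup>+z. (\<Prod>i\<in>I. r (z i) * indicator (A i) (z i)) \<partial>Pi\<^sub>M I (\<lambda>_. M))"
    proof (rule nn_integral_cong)
      fix z assume "z \<in> space (Pi\<^sub>M I (\<lambda>_. M))"
      then have z: "z \<in> extensional I" by (auto simp: space_PiM PiE_def)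
      have "(indicator (Pi\<^sub>E I A) z :: ennreal) = (\<Prod>i\<in>I. indicator (A i) (z i))"
      proof (cases "z \<in> Pi\<^sub>E I A")
        case False
        then obtain i where "i \<in> I" "z i \<notin> A i" using z by (auto simp: PiE_def Pi_def)
        then have "(\<Prod>i\<in>I. indicator (A i) (z i) :: ennreal) = 0"
          using I by (intro prod_zero) (auto intro!: bexI[of _ i])
        with False show ?thesis by simp
      qed (auto simp: PiE_def Pi_def intro!: prod.neutral[symmetric])
      then show "(\<Prod>i\<in>I. r (z i)) * indicator (Pi\<^sub>E I A) z = (\<Prod>i\<in>I. r (z i) * indicator (A i) (z i))"
        by (simp add: prod.distrib)
    qed
    also have "\<dots> = (\<Prod>i\<in>I. \<integral>\<^sup>+y. r y * indicator (A i) y \<partial>M)"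
      using I by (intro M.product_nn_integral_prod) auto
    also have "\<dots> = (\<Prod>i\<in>I. emeasure (density M r) (A i))"
      using A by (intro prod.cong refl) (simp add: emeasure_density)
    finally show "emeasure (density (Pi\<^sub>M I (\<lambda>_. M)) (\<lambda>z. \<Prod>i\<in>I. r (z i))) (Pi\<^sub>E I A) =
         (\<Prod>i\<in>I. emeasure (density M r) (A i))" .
  qed
qed

text \<open>
  A weighted form of \<open>(v + w)\<^sup>2 \<le> (1 + e) v\<^sup>2 + (1 + 1/e) w\<^sup>2\<close> with \<open>w = u - v\<close>. It transfers closeness
  of square roots of densities to the densities with a factor close to 1 on the main term.
\<close>

lemma square_split_le:
  fixes u v e :: real
  assumes "e > 0"
  shows "u\<^sup>2 \<le> (1 + e) * v\<^sup>2 + (1 + 1 / e) * (u - v)\<^sup>2"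
proof -
  have "(1 + e) * v\<^sup>2 + (1 + 1 / e) * (u - v)\<^sup>2 - u\<^sup>2 = (e * v - (u - v))\<^sup>2 / e"
    using assms by (simp add: field_simps power2_eq_square)
  moreover have "\<dots> \<ge> 0" using assms by simp
  ultimately show ?thesis by linarith
qed

text \<open>
  A non-asymptotic Neyman-Pearson bound. Write \<open>R\<close> for the product likelihood ratio and \<open>J\<close> for the
  indicator that all coordinates lie in \<open>A\<close>. If \<open>R\<close> were exactly \<open>c * J\<close>, the power would be at most
  \<open>c\<close> times the size; the second summand is the cost of the approximation,
  \<open>E(sqrt R - sqrt c * J)\<^sup>2\<close>. Expanding that square leaves only integrals of products over the
  coordinates, and \<open>E[sqrt r] = (1 + P(A) - H)/2\<close> is the expansion of the one-coordinate Hellinger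
  term \<open>H\<close>.
\<close>

lemma product_test_bound:
  fixes r :: "'a \<Rightarrow> real" and \<psi> :: "('i \<Rightarrow> 'a) \<Rightarrow> real"
  assumes M: "prob_space M" and D: "prob_space (density M r)"
    and I: "finite I"
    and r[measurable]: "r \<in> borel_measurable M" and r0: "\<And>x. r x \<ge> 0"
    and A[measurable]: "A \<in> sets M" and rA: "\<And>x. x \<notin> A \<Longrightarrow> r x = 0"
    and \<psi>[measurable]: "\<psi> \<in> borel_measurable (PiM I (\<lambda>_. M))"
    and \<psi>01: "\<And>z. z \<in> space (PiM I (\<lambda>_. M)) \<Longrightarrow> 0 \<le> \<psi> z \<and> \<psi> z \<le> 1"
    and c: "c > 0" and e: "e > 0"
    and H: "H = (\<integral>x. (sqrt (r x) - indicator A x)\<^sup>2 \<partial>M)"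
  shows "(\<integral>z. \<psi> z \<partial>PiM I (\<lambda>_. density M r))
    \<le> (1 + e) * c * (\<integral>z. \<psi> z \<partial>PiM I (\<lambda>_. M))
      + (1 + 1 / e) * (1 + c * measure M A ^ card I
                        - 2 * sqrt c * ((1 + measure M A - H) / 2) ^ card I)"
proof -
  let ?P = "PiM I (\<lambda>_. M)"
  interpret M: prob_space M by fact
  interpret D: prob_space "density M r" by fact
  interpret P: product_prob_space "\<lambda>_. M" I by standard
  let ?i = "\<lambda>x. indicator A x :: real"
  define R where "R z = (\<Prod>i\<in>I. r (z i))" for z
  define S where "S z = (\<Prod>i\<in>I. sqrt (r (z i)))" for z
  define J where "J z = (\<Prod>i\<in>I. ?i (z i))" for z
  have "(\<integral>\<^sup>+x. ennreal (r x) \<partial>M) = 1"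
    using D.emeasure_space_1 by (simp add: emeasure_density cong: nn_integral_cong)
  then have ir: "integrable M r" and r1: "(\<integral>x. r x \<partial>M) = 1"
    using r0 by (auto simp: integrable_iff_bounded integral_eq_nn_integral)
  have ii: "integrable M ?i" by (intro M.integrable_const_bound[where B=1]) (auto split: split_indicator)
  have ih: "integrable M (\<lambda>x. sqrt (r x))"
  proof (rule Bochner_Integration.integrable_bound[of _ "\<lambda>x. 1 + r x"])
    show "integrable M (\<lambda>x. 1 + r x)" using ir by auto
    have "sqrt t \<le> 1 + t" if "t \<ge> 0" for t :: real
      using that by (intro real_le_lsqrt) (auto simp: power2_eq_square algebra_simps)
    then show "AE x in M. norm (sqrt (r x)) \<le> norm (1 + r x)" using r0 by (auto simp: add_nonneg_nonneg)
  qed auto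
  have sqi: "(sqrt (r x) - ?i x)\<^sup>2 = r x + ?i x - 2 * sqrt (r x)" for x
    using r0[of x] rA[of x] by (auto simp: power2_eq_square algebra_simps split: split_indicator)
  \<comment> \<open>Since \<open>r\<close> vanishes off \<open>A\<close>, the cross term of the Hellinger square is just \<open>sqrt r\<close>.\<close>
  have b: "(\<integral>x. sqrt (r x) \<partial>M) = (1 + measure M A - H) / 2"
    using ir ii ih unfolding H sqi by (simp add: r1)
  have iR: "integrable ?P R" and iS: "integrable ?P S" and iJ: "integrable ?P J"
    unfolding R_def S_def J_def
    by (intro P.product_integrable_prod I ir ih ii)+
  have vR: "(\<integral>z. R z \<partial>?P) = 1" and vS: "(\<integral>z. S z \<partial>?P) = ((1 + measure M A - H) / 2) ^ card I"
    and vJ: "(\<integral>z. J z \<partial>?P) = measure M A ^ card I"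
    unfolding R_def S_def J_def
    by (subst P.product_integral_prod; use I ir ih ii in \<open>simp add: r1 b\<close>)+
  have R0: "R z \<ge> 0" and S2: "(S z)\<^sup>2 = R z" and J01: "(J z)\<^sup>2 = J z" "0 \<le> J z" "J z \<le> 1" and SJ: "S z * J z = S z" for z
  proof -
    show "R z \<ge> 0" unfolding R_def by (intro prod_nonneg) (auto simp: r0)
    show "(S z)\<^sup>2 = R z" unfolding R_def S_def by (simp add: prod_power_distrib r0)
    show "(J z)\<^sup>2 = J z" unfolding J_def prod_power_distrib
      by (intro prod.cong refl) (auto split: split_indicator)
    show "0 \<le> J z" unfolding J_def by (intro prod_nonneg) auto
    show "J z \<le> 1" unfolding J_def by (intro prod_le_1) auto
    show "S z * J z = S z" unfolding S_def J_def prod.distrib[symmetric]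
      by (intro prod.cong refl) (auto split: split_indicator simp: rA)
  qed
  have [measurable]: "R \<in> borel_measurable ?P" "S \<in> borel_measurable ?P" "J \<in> borel_measurable ?P"
    using iR iS iJ by auto
  have dens: "PiM I (\<lambda>_. density M r) = density ?P (\<lambda>z. ennreal (R z))"
    using PiM_density[OF I M.sigma_finite_measure_axioms D.sigma_finite_measure_axioms]
    by (simp add: R_def prod_ennreal r0)
  have bound: "integrable ?P (\<lambda>z. f z * \<psi> z)" if f: "integrable ?P f" for f :: "_ \<Rightarrow> real"
  proof (rule Bochner_Integration.integrable_bound[OF f])
    show "AE z in ?P. norm (f z * \<psi> z) \<le> norm (f z)"
      using \<psi>01 by (auto simp: abs_mult intro!: AE_I2 mult_left_le)
  qed (use f in auto)
  have i\<psi>: "integrable ?P \<psi>" using bound[of "\<lambda>_. 1"] by simp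
  have "(\<integral>z. \<psi> z \<partial>PiM I (\<lambda>_. density M r)) = (\<integral>z. R z * \<psi> z \<partial>?P)"
    unfolding dens by (subst integral_density) (auto simp: R0)
  also have "\<dots> \<le> (\<integral>z. (1 + e) * c * \<psi> z + (1 + 1 / e) * (R z + c * J z - 2 * sqrt c * S z) \<partial>?P)"
  proof (rule integral_mono)
    fix z assume z: "z \<in> space ?P"
    note \<psi>' = \<psi>01[OF z]
    have sq: "(S z - sqrt c * J z)\<^sup>2 = R z + c * J z - 2 * sqrt c * S z"
    proof -
      have "(S z - sqrt c * J z)\<^sup>2 = (S z)\<^sup>2 + (sqrt c)\<^sup>2 * (J z)\<^sup>2 - 2 * sqrt c * (S z * J z)"
        by (simp add: power2_eq_square algebra_simps)
      also have "\<dots> = R z + c * J z - 2 * sqrt c * S z"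
        unfolding S2 SJ J01(1) using c by simp
      finally show ?thesis .
    qed
    have le: "R z \<le> (1 + e) * (c * J z) + (1 + 1 / e) * (R z + c * J z - 2 * sqrt c * S z)"
      using square_split_le[OF e, of "S z" "sqrt c * J z"] c
      unfolding sq by (simp add: S2 power_mult_distrib J01)
    have "R z * \<psi> z \<le> ((1 + e) * (c * J z) + (1 + 1 / e) * (R z + c * J z - 2 * sqrt c * S z)) * \<psi> z"
      using le \<psi>' by (intro mult_right_mono) auto
    also have "\<dots> \<le> (1 + e) * c * \<psi> z + (1 + 1 / e) * (R z + c * J z - 2 * sqrt c * S z)"
    proof -
      \<comment> \<open>On the main term the factor dropped is \<open>J \<le> 1\<close>, on the nonnegative error term it is \<open>\<psi> \<le> 1\<close>.\<close>
      have "(1 + e) * c * \<psi> z * J z \<le> (1 + e) * c * \<psi> z"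
        using \<psi>' c e J01[of z] by (intro mult_left_le) auto
      moreover have "(1 + 1 / e) * (R z + c * J z - 2 * sqrt c * S z) * \<psi> z
          \<le> (1 + 1 / e) * (R z + c * J z - 2 * sqrt c * S z)"
        using \<psi>' e unfolding sq[symmetric] by (intro mult_left_le) auto
      ultimately show ?thesis by (simp add: algebra_simps)
    qed
    finally show "R z * \<psi> z \<le> \<dots>" .
  qed (intro bound iR Bochner_Integration.integrable_add Bochner_Integration.integrable_diff
        integrable_mult_right i\<psi> iS iJ)+
  also have "\<dots> = (1 + e) * c * (\<integral>z. \<psi> z \<partial>?P) + (1 + 1 / e) * (1 + c * measure M A ^ card I
                        - 2 * sqrt c * ((1 + measure M A - H) / 2) ^ card I)"
    using i\<psi> iR iS iJ by (simp add: vR vS vJ)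
  finally show ?thesis .
qed

section \<open>A one-parameter path of boundary models\<close>

lemma measurable_pair_count_space2:
  assumes "countable A" "\<And>x. x \<in> A \<Longrightarrow> (\<lambda>y. f (y, x)) \<in> measurable N K"
  shows "f \<in> measurable (N \<Otimes>\<^sub>M count_space A) K"
proof -
  have "(\<lambda>(x, y). f (y, x)) \<in> measurable (count_space A \<Otimes>\<^sub>M N) K"
    using assms by (intro measurable_pair_measure_countable1) auto
  from measurable_compose[OF measurable_pair_swap' this] show ?thesis
    by (simp add: case_prod_beta)
qed

text \<open>
  The consequences of the regularity conditions along the path \<open>\<theta> \<mapsto> (\<theta>, \<gamma>)\<close> with \<open>\<gamma>\<close> held at its true
  value: only derivatives in the direction of \<open>\<theta>\<close> enter, and \<open>fdot\<close> is this partial derivative of the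
  density.
\<close>

locale regular_boundary_path =
  fixes m :: "('x::euclidean_space, 'g::euclidean_space) boundary_model"
    and \<gamma> :: 'g and \<theta>\<^sub>0 \<eta> C :: real
    and fdot :: "real \<Rightarrow> 'x \<Rightarrow> real \<Rightarrow> real" and g' :: "'x \<Rightarrow> real \<Rightarrow> real"
  assumes finite_X: "finite (Xset m)"
    and px_pos: "a \<in> Xset m \<Longrightarrow> px m a > 0"
    and px_sum: "(\<Sum>a\<in>Xset m. px m a) = 1"
    and Y_borel[measurable]: "Yset m \<in> sets borel"
    and bdry_interior: "a \<in> Xset m \<Longrightarrow> bdry m a \<theta>\<^sub>0 \<in> interior (Yset m)"
    and eta_pos: "\<eta> > 0"
    and Theta_near: "\<bar>\<theta> - \<theta>\<^sub>0\<bar> < \<eta> \<Longrightarrow> \<theta> \<in> Theta_set m"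
    and dens_measurable: "\<bar>\<theta> - \<theta>\<^sub>0\<bar> < \<eta> \<Longrightarrow> a \<in> Xset m \<Longrightarrow>
          set_borel_measurable borel (supp m a \<theta>) (\<lambda>y. dens m y a (\<theta>, \<gamma>))"
    and dens_total: "\<bar>\<theta> - \<theta>\<^sub>0\<bar> < \<eta> \<Longrightarrow> a \<in> Xset m \<Longrightarrow>
          (\<integral>\<^sup>+y\<in>supp m a \<theta>. ennreal (dens m y a (\<theta>, \<gamma>)) \<partial>lborel) = 1"
    and bdry_deriv: "\<bar>\<theta> - \<theta>\<^sub>0\<bar> < \<eta> \<Longrightarrow> a \<in> Xset m \<Longrightarrow>
          (bdry m a has_real_derivative g' a \<theta>) (at \<theta>)"
    and bdry_deriv_pos: "\<bar>\<theta> - \<theta>\<^sub>0\<bar> < \<eta> \<Longrightarrow> a \<in> Xset m \<Longrightarrow> g' a \<theta> > 0"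
    and dens_continuous: "a \<in> Xset m \<Longrightarrow> continuous_on (Yset m) (\<lambda>y. dens m y a (\<theta>\<^sub>0, \<gamma>))"
    and dens_deriv: "\<bar>\<theta> - \<theta>\<^sub>0\<bar> < \<eta> \<Longrightarrow> a \<in> Xset m \<Longrightarrow> y \<in> Yset m \<Longrightarrow>
          ((\<lambda>t. dens m y a (t, \<gamma>)) has_real_derivative fdot y a \<theta>) (at \<theta>)"
    and dens_pos: "\<bar>\<theta> - \<theta>\<^sub>0\<bar> < \<eta> \<Longrightarrow> a \<in> Xset m \<Longrightarrow> y \<in> Yset m \<Longrightarrow> dens m y a (\<theta>, \<gamma>) > 0"
    and fdot_bound: "\<bar>\<theta> - \<theta>\<^sub>0\<bar> < \<eta> \<Longrightarrow> a \<in> Xset m \<Longrightarrow> y \<in> Yset m \<Longrightarrow> \<bar>fdot y a \<theta>\<bar> \<le> C"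
    and score_integrable: "a \<in> Xset m \<Longrightarrow>
          (\<integral>\<^sup>+y\<in>Yset m. (SUP \<theta>\<in>{\<theta>. \<bar>\<theta> - \<theta>\<^sub>0\<bar> < \<eta>}. ennreal
             ((fdot y a \<theta>)\<^sup>2 / (dens m y a (\<theta>, \<gamma>))\<^sup>2 * indicator {bdry m a \<theta>..} y * dens m y a (\<theta>, \<gamma>)))
           \<partial>lborel) < \<infinity>"
begin

abbreviation Q :: "real \<Rightarrow> (real \<times> 'x) measure" where "Q \<theta> \<equiv> obs_law m (\<theta>, \<gamma>)"
abbreviation F :: "real \<Rightarrow> 'x \<Rightarrow> real \<Rightarrow> real" where "F y a \<theta> \<equiv> dens m y a (\<theta>, \<gamma>)"
abbreviation obs_space :: "(real \<times> 'x) measure" where "obs_space \<equiv> borel \<Otimes>\<^sub>M count_space (Xset m)"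

lemma sets_obs_law: "sets (obs_law m \<beta>) = sets obs_space"
  unfolding obs_law_def X_law_def sets_density
  by (intro sets_pair_measure_cong) (simp_all add: sets_point_measure)

lemma space_obs_law: "space (obs_law m \<beta>) = UNIV \<times> Xset m"
  using sets_eq_imp_space_eq[OF sets_obs_law] by (simp add: space_pair_measure)

lemma borel_measurable_obs_spaceI:
  assumes "\<And>a. a \<in> Xset m \<Longrightarrow> (\<lambda>y. u (y, a)) \<in> borel_measurable borel"
  shows "u \<in> borel_measurable obs_space"
  by (intro measurable_pair_count_space2 countable_finite finite_X assms)

lemma dens_supp_measurable:
  assumes "\<bar>\<theta> - \<theta>\<^sub>0\<bar> < \<eta>" "a \<in> Xset m"
  shows "(\<lambda>y. F y a \<theta> * indicator (supp m a \<theta>) y) \<in> borel_measurable borel"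
  using dens_measurable[OF assms] by (simp add: set_borel_measurable_def mult.commute)

lemma ennreal_dens_supp_measurable:
  assumes "\<bar>\<theta> - \<theta>\<^sub>0\<bar> < \<eta>" "a \<in> Xset m"
  shows "(\<lambda>y. ennreal (F y a \<theta>) * indicator (supp m a \<theta>) y) \<in> borel_measurable borel"
proof -
  have "(\<lambda>y. ennreal (F y a \<theta> * indicator (supp m a \<theta>) y)) \<in> borel_measurable borel"
    using dens_supp_measurable[OF assms] by simp
  moreover have "(\<lambda>y. ennreal (F y a \<theta> * indicator (supp m a \<theta>) y)) = (\<lambda>y. ennreal (F y a \<theta>) * indicator (supp m a \<theta>) y)"
    by (auto split: split_indicator)
  ultimately show ?thesis by simp
qed

lemma obs_density_measurable:
  assumes "\<bar>\<theta> - \<theta>\<^sub>0\<bar> < \<eta>"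
  shows "(\<lambda>(y, x). ennreal (F y x \<theta>) * indicator (supp m x \<theta>) y) \<in> borel_measurable obs_space"
  by (rule borel_measurable_obs_spaceI) (simp add: ennreal_dens_supp_measurable[OF assms])

lemma borel_measurable_base: "borel_measurable (lborel \<Otimes>\<^sub>M X_law m) = borel_measurable obs_space"
  unfolding X_law_def
  by (intro measurable_cong_sets sets_pair_measure_cong refl) (simp_all add: sets_point_measure)

text \<open>
  Tonelli: as the covariate has finitely many values, every probability below becomes a finite sum of
  one-dimensional integrals.
\<close>

lemma nn_integral_obs_law:
  assumes \<theta>: "\<bar>\<theta> - \<theta>\<^sub>0\<bar> < \<eta>" and u: "u \<in> borel_measurable obs_space"
  shows "(\<integral>\<^sup>+z. u z \<partial>Q \<theta>) = (\<Sum>a\<in>Xset m. ennreal (px m a) *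
            (\<integral>\<^sup>+y. u (y, a) * (ennreal (F y a \<theta>) * indicator (supp m a \<theta>) y) \<partial>lborel))"
proof -
  interpret X: finite_measure "X_law m"
    by (rule finite_measureI)
       (simp add: X_law_def space_point_measure emeasure_point_measure_finite finite_X)
  interpret P: pair_sigma_finite lborel "X_law m" by standard
  let ?d = "\<lambda>(y, x). ennreal (F y x \<theta>) * indicator (supp m x \<theta>) y"
  have d: "?d \<in> borel_measurable (lborel \<Otimes>\<^sub>M X_law m)" and u': "u \<in> borel_measurable (lborel \<Otimes>\<^sub>M X_law m)"
    using u obs_density_measurable[OF \<theta>] by (simp_all only: borel_measurable_base)
  have "(\<integral>\<^sup>+z. u z \<partial>Q \<theta>) = (\<integral>\<^sup>+z. ?d z * u z \<partial>(lborel \<Otimes>\<^sub>M X_law m))"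
    unfolding obs_law_def fst_conv using d u' by (intro nn_integral_density) auto
  also have "\<dots> = (\<integral>\<^sup>+x. \<integral>\<^sup>+y. ?d (y, x) * u (y, x) \<partial>lborel \<partial>X_law m)"
    using d u' by (intro P.nn_integral_snd[symmetric]) auto
  also have "\<dots> = (\<Sum>a\<in>Xset m. ennreal (px m a) * (\<integral>\<^sup>+y. ?d (y, a) * u (y, a) \<partial>lborel))"
    unfolding X_law_def using finite_X by (subst nn_integral_point_measure_finite) auto
  finally show ?thesis by (simp add: mult_ac)
qed

lemma prob_space_obs_law:
  assumes "\<bar>\<theta> - \<theta>\<^sub>0\<bar> < \<eta>"
  shows "prob_space (Q \<theta>)"
proof
  have "emeasure (Q \<theta>) (space (Q \<theta>)) = (\<integral>\<^sup>+z. 1 \<partial>Q \<theta>)" by simp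
  also have "\<dots> = (\<Sum>a\<in>Xset m. ennreal (px m a) * 1)"
    by (subst nn_integral_obs_law[OF assms])
       (auto simp: dens_total[OF assms] intro!: sum.cong)
  also have "\<dots> = ennreal (\<Sum>a\<in>Xset m. px m a)"
    by (simp add: sum_ennreal px_pos less_imp_le)
  finally show "emeasure (Q \<theta>) (space (Q \<theta>)) = 1" by (simp add: px_sum)
qed

lemma bdry_strict_mono:
  assumes "\<bar>s - \<theta>\<^sub>0\<bar> < \<eta>" "\<bar>t - \<theta>\<^sub>0\<bar> < \<eta>" "s < t" "a \<in> Xset m"
  shows "bdry m a s < bdry m a t"
proof (rule DERIV_pos_imp_increasing[OF \<open>s < t\<close>])
  fix u assume "s \<le> u" "u \<le> t"
  then have "\<bar>u - \<theta>\<^sub>0\<bar> < \<eta>" using assms by auto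
  then show "\<exists>y. DERIV (bdry m a) u :> y \<and> 0 < y"
    using bdry_deriv bdry_deriv_pos assms(4) by blast
qed

lemma bdry_mono:
  assumes "\<bar>s - \<theta>\<^sub>0\<bar> < \<eta>" "\<bar>t - \<theta>\<^sub>0\<bar> < \<eta>" "s \<le> t" "a \<in> Xset m"
  shows "bdry m a s \<le> bdry m a t"
  using bdry_strict_mono[OF assms(1,2)] assms(3,4) by (cases "s = t") (auto simp: less_eq_real_def)

text \<open>
  Joint continuity of the density in \<open>(y, \<theta>)\<close> at the boundary point: continuity in \<open>y\<close> at \<open>\<theta>\<^sub>0\<close> is
  combined with a Lipschitz bound in \<open>\<theta>\<close> that is uniform in \<open>y\<close>.
\<close>

lemma dens_near_bdry:
  assumes a: "a \<in> Xset m" and e: "e > 0"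
  obtains d where "d > 0" "\<And>y s. \<bar>y - bdry m a \<theta>\<^sub>0\<bar> < d \<Longrightarrow> \<bar>s - \<theta>\<^sub>0\<bar> < d \<Longrightarrow>
     \<bar>s - \<theta>\<^sub>0\<bar> < \<eta> \<and> y \<in> Yset m \<and> \<bar>F y a s - F (bdry m a \<theta>\<^sub>0) a \<theta>\<^sub>0\<bar> \<le> e"
proof -
  let ?b = "bdry m a \<theta>\<^sub>0"
  have bY: "?b \<in> Yset m" using bdry_interior[OF a] interior_subset by blast
  obtain d1 where d1: "d1 > 0" "ball ?b d1 \<subseteq> Yset m"
    using bdry_interior[OF a] unfolding mem_interior by blast
  obtain d2 where d2: "d2 > 0" "\<And>y. y \<in> Yset m \<Longrightarrow> dist y ?b < d2 \<Longrightarrow> dist (F y a \<theta>\<^sub>0) (F ?b a \<theta>\<^sub>0) < e / 2"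
    using dens_continuous[OF a, unfolded continuous_on_iff, rule_format, OF bY half_gt_zero[OF e]] by blast
  have C: "0 \<le> C" using fdot_bound[OF _ a bY, of \<theta>\<^sub>0] eta_pos by auto
  have lip: "\<bar>F y a s - F y a \<theta>\<^sub>0\<bar> \<le> C * \<bar>s - \<theta>\<^sub>0\<bar>" if "y \<in> Yset m" "\<bar>s - \<theta>\<^sub>0\<bar> < \<eta>" for y s
  proof -
    have "norm (F y a s - F y a \<theta>\<^sub>0) \<le> C * norm (s - \<theta>\<^sub>0)"
    proof (rule field_differentiable_bound[where S = "ball \<theta>\<^sub>0 \<eta>"])
      fix u assume "u \<in> ball \<theta>\<^sub>0 \<eta>"
      then have u: "\<bar>u - \<theta>\<^sub>0\<bar> < \<eta>" by (simp add: dist_real_def abs_minus_commute)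
      show "((\<lambda>t. F y a t) has_field_derivative fdot y a u) (at u within ball \<theta>\<^sub>0 \<eta>)"
        using dens_deriv[OF u a that(1)] by (rule has_field_derivative_at_within)
      show "norm (fdot y a u) \<le> C" using fdot_bound[OF u a that(1)] by simp
    qed (use that eta_pos in \<open>auto simp: dist_real_def abs_minus_commute\<close>)
    then show ?thesis by simp
  qed
  define d where "d = Min {d1, d2, \<eta>, e / (2 * (C + 1))}"
  have d: "d > 0" "d \<le> d1" "d \<le> d2" "d \<le> \<eta>" "d \<le> e / (2 * (C + 1))"
    using d1 d2 eta_pos e C by (auto simp: d_def)
  show ?thesis
  proof (rule that[OF d(1)])
    fix y s assume y: "\<bar>y - ?b\<bar> < d" and s: "\<bar>s - \<theta>\<^sub>0\<bar> < d"
    have yY: "y \<in> Yset m" using d1(2) d y by (auto simp: subset_eq dist_real_def abs_minus_commute)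
    have "\<bar>F y a \<theta>\<^sub>0 - F ?b a \<theta>\<^sub>0\<bar> < e / 2" using d2(2)[OF yY] y d by (simp add: dist_real_def)
    moreover have "\<bar>F y a s - F y a \<theta>\<^sub>0\<bar> \<le> e / 2"
    proof -
      have "\<bar>F y a s - F y a \<theta>\<^sub>0\<bar> \<le> C * \<bar>s - \<theta>\<^sub>0\<bar>" using lip[OF yY] s d by simp
      also have "\<dots> \<le> (C + 1) * (e / (2 * (C + 1)))" using s d C by (intro mult_mono) auto
      also have "\<dots> = e / 2" using C by (simp add: field_simps)
      finally show ?thesis .
    qed
    ultimately show "\<bar>s - \<theta>\<^sub>0\<bar> < \<eta> \<and> y \<in> Yset m \<and> \<bar>F y a s - F ?b a \<theta>\<^sub>0\<bar> \<le> e"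
      using s d(4) yY by linarith
  qed
qed

text \<open>
  The inequality is weak, as in the support of the model, so that the sample drawn at \<open>\<theta>\<close> lies in
  \<open>above \<theta>\<close> almost surely. The test compares strictly; the difference disappears in the sandwich
  between nearby parameters.
\<close>

definition above :: "real \<Rightarrow> (real \<times> 'x) set" where
  "above \<theta> = {z \<in> space obs_space. bdry m (snd z) \<theta> \<le> fst z}"

lemma above_measurable[measurable]: "above \<theta> \<in> sets obs_space"
proof -
  have "(\<lambda>z. indicator {bdry m (snd z) \<theta>..} (fst z) :: real) \<in> borel_measurable obs_space"
    by (rule borel_measurable_obs_spaceI) simp
  then have "{z \<in> space obs_space. indicator {bdry m (snd z) \<theta>..} (fst z) = (1::real)} \<in> sets obs_space" by measurable
  moreover have "{z \<in> space obs_space. indicator {bdry m (snd z) \<theta>..} (fst z) = (1::real)} = above \<theta>"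
    by (auto simp: above_def indicator_def)
  ultimately show ?thesis by simp
qed

section \<open>Probability of falling below a moved boundary\<close>

text \<open>
  The intensity of observations at the boundary per unit of the local parameter, that is \<open>1/\<lambda>\<close>.
\<close>

definition rate :: real where
  "rate = (\<Sum>a\<in>Xset m. px m a * (F (bdry m a \<theta>\<^sub>0) a \<theta>\<^sub>0 * g' a \<theta>\<^sub>0))"

lemma eventually_local:
  assumes "d > 0"
  shows "\<forall>\<^sub>F n in sequentially. \<bar>(\<theta>\<^sub>0 + h / real n) - \<theta>\<^sub>0\<bar> < d"
proof -
  have "(\<lambda>n. h / real n) \<longlonglongrightarrow> 0" by (rule lim_const_over_n)
  from tendstoD[OF this assms] show ?thesis by (simp add: dist_real_def)
qed

lemma measure_not_above:
  assumes s: "\<bar>s - \<theta>\<^sub>0\<bar> < \<eta>"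
  shows "1 - measure (Q s) (above t) = (\<Sum>a\<in>Xset m. px m a *
     enn2real (\<integral>\<^sup>+y. ennreal (F y a s) * indicator (supp m a s \<inter> {..<bdry m a t}) y \<partial>lborel))"
proof -
  interpret prob_space "Q s" by (rule prob_space_obs_law[OF s])
  let ?w = "\<lambda>a. \<integral>\<^sup>+y. ennreal (F y a s) * indicator (supp m a s \<inter> {..<bdry m a t}) y \<partial>lborel"
  have A: "above t \<in> sets (Q s)" by (simp add: sets_obs_law)
  have fin: "?w a < \<infinity>" if "a \<in> Xset m" for a
  proof -
    have "?w a \<le> (\<integral>\<^sup>+y\<in>supp m a s. ennreal (F y a s) \<partial>lborel)"
      by (intro nn_integral_mono) (auto split: split_indicator)
    then show ?thesis by (simp add: dens_total[OF s that] order_le_less_trans[of _ 1])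
  qed
  have "1 - measure (Q s) (above t) = prob (space (Q s) - above t)"
    by (rule prob_compl[OF A, symmetric])
  also have "\<dots> = enn2real (\<integral>\<^sup>+z. indicator (space (Q s) - above t) z \<partial>Q s)"
    using A by (simp add: measure_def)
  also have "(\<integral>\<^sup>+z. indicator (space (Q s) - above t) z \<partial>Q s) = (\<Sum>a\<in>Xset m. ennreal (px m a) * ?w a)"
  proof (subst nn_integral_obs_law[OF s])
    show "indicator (space (Q s) - above t) \<in> borel_measurable obs_space"
      using A sets_obs_law by (intro borel_measurable_indicator) blast
    show "(\<Sum>a\<in>Xset m. ennreal (px m a) * (\<integral>\<^sup>+ y. indicator (space (Q s) - above t) (y, a) *
             (ennreal (F y a s) * indicator (supp m a s) y) \<partial>lborel)) = (\<Sum>a\<in>Xset m. ennreal (px m a) * ?w a)"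
    proof (rule sum.cong[OF refl], rule arg_cong2[where f="(*)", OF refl], rule nn_integral_cong)
      fix a y assume "a \<in> Xset m"
      then have "(indicator (space (Q s) - above t) (y, a) * indicator (supp m a s) y :: ennreal)
          = indicator (supp m a s \<inter> {..<bdry m a t}) y"
        by (auto simp: space_obs_law above_def space_pair_measure indicator_def)
      then show "indicator (space (Q s) - above t) (y, a) * (ennreal (F y a s) * indicator (supp m a s) y)
          = ennreal (F y a s) * indicator (supp m a s \<inter> {..<bdry m a t}) y"
        by (simp only: mult.left_commute[of "indicator (space (Q s) - above t) (y, a)"])
    qed
  qed
  also have "\<dots> = (\<Sum>a\<in>Xset m. ennreal (px m a * enn2real (?w a)))"
    using fin px_pos by (intro sum.cong refl) (simp add: ennreal_mult'' less_imp_le)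
  also have "enn2real \<dots> = (\<Sum>a\<in>Xset m. px m a * enn2real (?w a))"
    using px_pos by (simp add: sum_ennreal less_imp_le sum_nonneg)
  finally show ?thesis .
qed

lemma measure_above_eq_1:
  assumes "\<bar>s - \<theta>\<^sub>0\<bar> < \<eta>" "\<bar>t - \<theta>\<^sub>0\<bar> < \<eta>" "t \<le> s"
  shows "measure (Q s) (above t) = 1"
proof -
  have "supp m a s \<inter> {..<bdry m a t} = {}" if "a \<in> Xset m" for a
    using bdry_mono[OF assms(2,1,3) that] by (auto simp: supp_def)
  then have "1 - measure (Q s) (above t) = 0"
    unfolding measure_not_above[OF assms(1)] by simp
  then show ?thesis by simp
qed

text \<open>
  The window between the two boundaries has width \<open>(k - h) * g' / n + o(1/n)\<close> and shrinks to a point at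
  which the density is continuous, so its mass is the width times the limiting density.
\<close>

lemma boundary_window_mass:
  assumes a: "a \<in> Xset m" and hk: "h \<le> k"
  shows "(\<lambda>n. real n * enn2real (\<integral>\<^sup>+y. ennreal (F y a (\<theta>\<^sub>0 + h / real n)) *
       indicator (supp m a (\<theta>\<^sub>0 + h / real n) \<inter> {..<bdry m a (\<theta>\<^sub>0 + k / real n)}) y \<partial>lborel))
     \<longlonglongrightarrow> F (bdry m a \<theta>\<^sub>0) a \<theta>\<^sub>0 * ((k - h) * g' a \<theta>\<^sub>0)"
    (is "(\<lambda>n. real n * enn2real (?w n)) \<longlonglongrightarrow> ?L * _")
proof (rule tendsto_mult_of_relative_error)
  let ?b = "bdry m a"
  let ?s = "\<lambda>n. \<theta>\<^sub>0 + h / real n" and ?t = "\<lambda>n. \<theta>\<^sub>0 + k / real n"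
  have D: "(?b has_real_derivative g' a \<theta>\<^sub>0) (at \<theta>\<^sub>0)"
    using bdry_deriv[OF _ a, of \<theta>\<^sub>0] eta_pos by simp
  show "(\<lambda>n. real n * (?b (?t n) - ?b (?s n))) \<longlonglongrightarrow> (k - h) * g' a \<theta>\<^sub>0"
    using tendsto_diff[OF scaled_difference_quotient[OF D, of k] scaled_difference_quotient[OF D, of h]]
    by (simp add: algebra_simps)
  fix e :: real assume e: "e > 0"
  obtain d where d: "d > 0" and near: "\<And>y s. \<bar>y - ?b \<theta>\<^sub>0\<bar> < d \<Longrightarrow> \<bar>s - \<theta>\<^sub>0\<bar> < d \<Longrightarrow>
     \<bar>s - \<theta>\<^sub>0\<bar> < \<eta> \<and> y \<in> Yset m \<and> \<bar>F y a s - ?L\<bar> \<le> e"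
    using dens_near_bdry[OF a e] by blast
  have lim: "(\<lambda>n. ?b (\<theta>\<^sub>0 + q / real n)) \<longlonglongrightarrow> ?b \<theta>\<^sub>0" for q
  proof (rule isCont_tendsto_compose[of \<theta>\<^sub>0 ?b])
    show "isCont ?b \<theta>\<^sub>0" using D by (rule DERIV_isCont)
    show "(\<lambda>n. \<theta>\<^sub>0 + q / real n) \<longlonglongrightarrow> \<theta>\<^sub>0"
      using tendsto_add[OF tendsto_const lim_const_over_n[of q]] by simp
  qed
  have close: "\<forall>\<^sub>F n in sequentially. \<bar>?b (\<theta>\<^sub>0 + q / real n) - ?b \<theta>\<^sub>0\<bar> < d" for q
    using tendstoD[OF lim d] by (simp add: dist_real_def)
  show "\<forall>\<^sub>F n in sequentially. \<bar>real n * enn2real (?w n) - ?L * (real n * (?b (?t n) - ?b (?s n)))\<bar>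
           \<le> e * (real n * (?b (?t n) - ?b (?s n)))"
    using close[of h] close[of k] eventually_local[OF d, of h]
      eventually_local[OF eta_pos, of h] eventually_local[OF eta_pos, of k]
  proof eventually_elim
    case (elim n)
    let ?\<Delta> = "?b (?t n) - ?b (?s n)"
    have \<Delta>: "0 \<le> ?\<Delta>"
      using bdry_mono[OF elim(4,5) _ a] hk by (simp add: divide_right_mono)
    have on: "y \<in> Yset m \<and> \<bar>F y a (?s n) - ?L\<bar> \<le> e" if "?b (?s n) \<le> y" "y < ?b (?t n)" for y
      using near[of y "?s n"] that elim by auto
    have up: "?w n \<le> ennreal ((?L + e) * ?\<Delta>)"
    proof -
      have "?w n \<le> (\<integral>\<^sup>+y. ennreal (?L + e) * indicator {?b (?s n)..<?b (?t n)} y \<partial>lborel)"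
      proof (rule nn_integral_mono)
        fix y
        show "ennreal (F y a (?s n)) * indicator (supp m a (?s n) \<inter> {..<?b (?t n)}) y
            \<le> ennreal (?L + e) * indicator {?b (?s n)..<?b (?t n)} y"
        proof (cases "?b (?s n) \<le> y \<and> y < ?b (?t n)")
          case True
          then have "F y a (?s n) \<le> ?L + e" using on[of y] by linarith
          with True show ?thesis by (auto simp: indicator_def intro: ennreal_leI)
        qed (auto simp: supp_def indicator_def)
      qed
      also have "\<dots> = ennreal (?L + e) * ennreal ?\<Delta>"
        using \<Delta> by (simp add: nn_integral_cmult)
      finally show ?thesis using \<Delta> by (simp add: ennreal_mult'')
    qed
    have low: "ennreal ((?L - e) * ?\<Delta>) \<le> ?w n"
    proof -
      have "ennreal ((?L - e) * ?\<Delta>) = (\<integral>\<^sup>+y. ennreal (?L - e) * indicator {?b (?s n)..<?b (?t n)} y \<partial>lborel)"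
        using \<Delta> by (simp add: nn_integral_cmult ennreal_mult'')
      also have "\<dots> \<le> ?w n"
      proof (rule nn_integral_mono)
        fix y
        show "ennreal (?L - e) * indicator {?b (?s n)..<?b (?t n)} y
           \<le> ennreal (F y a (?s n)) * indicator (supp m a (?s n) \<inter> {..<?b (?t n)}) y"
        proof (cases "?b (?s n) \<le> y \<and> y < ?b (?t n)")
          case True
          then have "?L - e \<le> F y a (?s n)" "y \<in> Yset m" using on[of y] by linarith+
          with True show ?thesis by (auto simp: indicator_def supp_def intro: ennreal_leI)
        qed (auto simp: indicator_def)
      qed
      finally show ?thesis .
    qed
    have Lpos: "?L > 0"
      using dens_pos[OF _ a subsetD[OF interior_subset bdry_interior[OF a]], of \<theta>\<^sub>0] eta_pos by simp
    have "?w n < top" using up by (rule order_le_less_trans) simp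
    have "enn2real (?w n) \<le> (?L + e) * ?\<Delta>"
      using up \<Delta> Lpos e by (intro enn2real_leI) auto
    moreover have "(?L - e) * ?\<Delta> \<le> enn2real (?w n)"
    proof -
      have "enn2real (ennreal ((?L - e) * ?\<Delta>)) \<le> enn2real (?w n)"
        using low \<open>?w n < top\<close> by (rule enn2real_mono)
      moreover have "(?L - e) * ?\<Delta> \<le> enn2real (ennreal ((?L - e) * ?\<Delta>))"
        by (cases "0 \<le> (?L - e) * ?\<Delta>") (auto simp: ennreal_neg)
      ultimately show ?thesis by (rule order_trans[rotated])
    qed
    ultimately have "\<bar>enn2real (?w n) - ?L * ?\<Delta>\<bar> \<le> e * ?\<Delta>"
      by (auto simp: algebra_simps abs_le_iff)
    then have "real n * \<bar>enn2real (?w n) - ?L * ?\<Delta>\<bar> \<le> real n * (e * ?\<Delta>)"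
      by (rule mult_left_mono) simp
    moreover have "real n * \<bar>enn2real (?w n) - ?L * ?\<Delta>\<bar> = \<bar>real n * (enn2real (?w n) - ?L * ?\<Delta>)\<bar>"
      by (simp add: abs_mult)
    moreover have "real n * (enn2real (?w n) - ?L * ?\<Delta>) = real n * enn2real (?w n) - ?L * (real n * ?\<Delta>)"
      by (simp only: right_diff_distrib mult.left_commute)
    ultimately show ?case by (simp only: mult.left_commute[of e])
  qed
qed

lemma mass_below_boundary:
  "(\<lambda>n. real n * (1 - measure (Q (\<theta>\<^sub>0 + h / real n)) (above (\<theta>\<^sub>0 + k / real n))))
     \<longlonglongrightarrow> rate * max 0 (k - h)"
proof (cases "h \<le> k")
  case True
  have "(\<lambda>n. \<Sum>a\<in>Xset m. px m a * (real n * enn2real (\<integral>\<^sup>+y. ennreal (F y a (\<theta>\<^sub>0 + h / real n)) *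
       indicator (supp m a (\<theta>\<^sub>0 + h / real n) \<inter> {..<bdry m a (\<theta>\<^sub>0 + k / real n)}) y \<partial>lborel)))
     \<longlonglongrightarrow> (\<Sum>a\<in>Xset m. px m a * (F (bdry m a \<theta>\<^sub>0) a \<theta>\<^sub>0 * ((k - h) * g' a \<theta>\<^sub>0)))"
    by (intro tendsto_sum tendsto_mult tendsto_const boundary_window_mass True)
  also have "(\<Sum>a\<in>Xset m. px m a * (F (bdry m a \<theta>\<^sub>0) a \<theta>\<^sub>0 * ((k - h) * g' a \<theta>\<^sub>0))) = rate * max 0 (k - h)"
    using True by (simp add: rate_def sum_distrib_left mult_ac)
  finally show ?thesis
  proof (rule Lim_transform_eventually)
    show "\<forall>\<^sub>F n in sequentially. (\<Sum>a\<in>Xset m. px m a * (real n * enn2real (\<integral>\<^sup>+y. ennreal (F y a (\<theta>\<^sub>0 + h / real n)) *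
       indicator (supp m a (\<theta>\<^sub>0 + h / real n) \<inter> {..<bdry m a (\<theta>\<^sub>0 + k / real n)}) y \<partial>lborel)))
       = real n * (1 - measure (Q (\<theta>\<^sub>0 + h / real n)) (above (\<theta>\<^sub>0 + k / real n)))"
      using eventually_local[OF eta_pos, of h]
      by eventually_elim (simp add: measure_not_above sum_distrib_left mult_ac)
  qed
next
  case False
  have "\<forall>\<^sub>F n in sequentially. 0 = real n * (1 - measure (Q (\<theta>\<^sub>0 + h / real n)) (above (\<theta>\<^sub>0 + k / real n)))"
    using eventually_local[OF eta_pos, of h] eventually_local[OF eta_pos, of k]
    by eventually_elim (use False in \<open>simp add: measure_above_eq_1 divide_right_mono\<close>)
  with False show ?thesis by (auto intro: Lim_transform_eventually[OF tendsto_const])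
qed

section \<open>Likelihood ratios for a single observation\<close>

text \<open>
  The likelihood ratio of \<open>t\<close> against \<open>\<theta>\<^sub>0\<close>. Being 0 off the support at \<open>t\<close>, it carries the indicator of
  that support, the only part of the likelihood whose product over \<open>n\<close> observations stays random in
  the limit.
\<close>

definition ratio :: "real \<Rightarrow> real \<times> 'x \<Rightarrow> real" where
  "ratio t z = (if snd z \<in> Xset m \<and> fst z \<in> supp m (snd z) t
                then F (fst z) (snd z) t / F (fst z) (snd z) \<theta>\<^sub>0 else 0)"

lemma base_near: "\<bar>\<theta>\<^sub>0 - \<theta>\<^sub>0\<bar> < \<eta>"
  using eta_pos by simp

lemma supp_antimono:
  assumes "\<bar>t - \<theta>\<^sub>0\<bar> < \<eta>" "\<theta>\<^sub>0 \<le> t" "a \<in> Xset m"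
  shows "supp m a t \<subseteq> supp m a \<theta>\<^sub>0"
  using bdry_mono[OF base_near assms] by (auto simp: supp_def)

lemma ratio_nonneg:
  assumes "\<bar>t - \<theta>\<^sub>0\<bar> < \<eta>"
  shows "ratio t z \<ge> 0"
  using dens_pos[OF assms] dens_pos[OF base_near]
  by (auto simp: ratio_def supp_def intro!: divide_nonneg_nonneg less_imp_le)

lemma ratio_measurable:
  assumes t: "\<bar>t - \<theta>\<^sub>0\<bar> < \<eta>" "\<theta>\<^sub>0 \<le> t"
  shows "ratio t \<in> borel_measurable obs_space"
proof (rule borel_measurable_obs_spaceI)
  fix a assume a: "a \<in> Xset m"
  have "(\<lambda>y. (F y a t * indicator (supp m a t) y) / (F y a \<theta>\<^sub>0 * indicator (supp m a \<theta>\<^sub>0) y)) \<in> borel_measurable borel"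
    by (intro borel_measurable_divide dens_supp_measurable t base_near a)
  also have "(\<lambda>y. (F y a t * indicator (supp m a t) y) / (F y a \<theta>\<^sub>0 * indicator (supp m a \<theta>\<^sub>0) y)) = (\<lambda>y. ratio t (y, a))"
    using supp_antimono[OF t a] a by (auto simp: ratio_def indicator_def fun_eq_iff)
  finally show "(\<lambda>y. ratio t (y, a)) \<in> borel_measurable borel" .
qed

text \<open>
  Moving the parameter up shrinks the support, so the law at \<open>t \<ge> \<theta>\<^sub>0\<close> is dominated by the law at
  \<open>\<theta>\<^sub>0\<close>. Domination fails in the other direction, which is why \<open>\<theta>\<^sub>0\<close> is the reference law.
\<close>

lemma obs_law_density_ratio:
  assumes t: "\<bar>t - \<theta>\<^sub>0\<bar> < \<eta>" "\<theta>\<^sub>0 \<le> t"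
  shows "Q t = density (Q \<theta>\<^sub>0) (\<lambda>z. ennreal (ratio t z))"
proof -
  let ?M = "(lborel :: real measure) \<Otimes>\<^sub>M X_law m"
  let ?d = "\<lambda>t (y, x). ennreal (F y x t) * indicator (supp m x t) y"
  have r: "(\<lambda>z. ennreal (ratio t z)) \<in> borel_measurable ?M"
    using ratio_measurable[OF t] unfolding borel_measurable_base by simp
  have d: "?d \<theta>\<^sub>0 \<in> borel_measurable ?M" "?d t \<in> borel_measurable ?M"
    using obs_density_measurable[OF base_near] obs_density_measurable[OF t(1)]
    unfolding borel_measurable_base by auto
  have "density (Q \<theta>\<^sub>0) (\<lambda>z. ennreal (ratio t z)) = density ?M (\<lambda>z. ?d \<theta>\<^sub>0 z * ennreal (ratio t z))"
    unfolding obs_law_def fst_conv by (rule density_density_eq[OF d(1) r])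
  also have "\<dots> = density ?M (?d t)"
  proof (rule density_cong)
    show "(\<lambda>z. ?d \<theta>\<^sub>0 z * ennreal (ratio t z)) \<in> borel_measurable ?M"
      by (rule borel_measurable_times_ennreal[OF d(1) r])
    show "AE z in ?M. ?d \<theta>\<^sub>0 z * ennreal (ratio t z) = ?d t z"
    proof (rule AE_I2)
      fix z assume "z \<in> space ?M"
      then obtain y a where z: "z = (y, a)" and a: "a \<in> Xset m"
        by (auto simp: space_pair_measure X_law_def space_point_measure)
      show "?d \<theta>\<^sub>0 z * ennreal (ratio t z) = ?d t z"
      proof (cases "y \<in> supp m a t")
        case True
        then have y0: "y \<in> supp m a \<theta>\<^sub>0" and Y: "y \<in> Yset m"
          using supp_antimono[OF t a] by (auto simp: supp_def)
        have "F y a \<theta>\<^sub>0 > 0" "F y a t > 0"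
          using dens_pos[OF base_near a Y] dens_pos[OF t(1) a Y] by auto
        then have "ennreal (F y a \<theta>\<^sub>0) * ennreal (F y a t / F y a \<theta>\<^sub>0) = ennreal (F y a t)"
          by (subst ennreal_mult[symmetric]) auto
        then show ?thesis using True y0 a by (simp add: z ratio_def)
      qed (simp add: z ratio_def)
    qed
  qed (rule d(2))
  finally show ?thesis by (simp add: obs_law_def)
qed

text \<open>
  With \<open>s\<close> the score for \<open>\<theta>\<close>, an upper bound for \<open>E[s\<^sup>2 | X = a]\<close>, uniform over the parameters near
  \<open>\<theta>\<^sub>0\<close>: the supremum is taken inside the integral.
\<close>

definition score_bound :: "'x \<Rightarrow> ennreal" where
  "score_bound a = (\<integral>\<^sup>+y\<in>Yset m. (SUP \<theta>\<in>{\<theta>. \<bar>\<theta> - \<theta>\<^sub>0\<bar> < \<eta>}. ennreal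
      ((fdot y a \<theta>)\<^sup>2 / (F y a \<theta>)\<^sup>2 * indicator {bdry m a \<theta>..} y * F y a \<theta>)) \<partial>lborel)"

text \<open>
  The derivative of \<open>sqrt f\<close> is \<open>s * sqrt f / 2\<close> with \<open>s\<close> the score, and its square is bounded by
  \<open>s\<^sup>2 * f\<close>, which \<open>score_bound\<close> controls at intermediate parameters. Controlling \<open>f(t)/f(\<theta>\<^sub>0)\<close>
  without the square root through the score would require exponential moments of the score.
\<close>

lemma sqrt_dens_increment:
  assumes t: "\<bar>t - \<theta>\<^sub>0\<bar> < \<eta>" "\<theta>\<^sub>0 < t" and a: "a \<in> Xset m" and y: "y \<in> supp m a t"
  shows "\<exists>\<theta>. \<bar>\<theta> - \<theta>\<^sub>0\<bar> < \<eta> \<and> bdry m a \<theta> \<le> y \<and>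
     (sqrt (F y a t) - sqrt (F y a \<theta>\<^sub>0))\<^sup>2 / (t - \<theta>\<^sub>0)\<^sup>2 \<le> (fdot y a \<theta>)\<^sup>2 / (F y a \<theta>)\<^sup>2 * F y a \<theta>"
proof -
  have Y: "y \<in> Yset m" using y by (simp add: supp_def)
  let ?D = "\<lambda>u. fdot y a u * (inverse (sqrt (F y a u)) / 2)"
  have "\<exists>z>\<theta>\<^sub>0. z < t \<and> sqrt (F y a t) - sqrt (F y a \<theta>\<^sub>0) = (t - \<theta>\<^sub>0) * ?D z"
  proof (rule MVT2[OF t(2)])
    fix u assume "\<theta>\<^sub>0 \<le> u" "u \<le> t"
    then have u: "\<bar>u - \<theta>\<^sub>0\<bar> < \<eta>" using t by auto
    show "DERIV (\<lambda>u. sqrt (F y a u)) u :> ?D u"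
      using dens_pos[OF u a Y] by (auto intro!: derivative_eq_intros dens_deriv[OF u a Y])
  qed
  then obtain u where u: "\<theta>\<^sub>0 < u" "u < t"
    and eq: "sqrt (F y a t) - sqrt (F y a \<theta>\<^sub>0) = (t - \<theta>\<^sub>0) * ?D u" by blast
  have near: "\<bar>u - \<theta>\<^sub>0\<bar> < \<eta>" using u t by auto
  have pos: "F y a u > 0" by (rule dens_pos[OF near a Y])
  have "(sqrt (F y a t) - sqrt (F y a \<theta>\<^sub>0))\<^sup>2 / (t - \<theta>\<^sub>0)\<^sup>2 = (?D u)\<^sup>2"
    unfolding eq power_mult_distrib[of "t - \<theta>\<^sub>0"] using t by simp
  also have "\<dots> = (fdot y a u)\<^sup>2 / (F y a u)\<^sup>2 * F y a u / 4"
    using pos by (simp add: power_mult_distrib power_divide power_inverse field_simps power2_eq_square)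
  also have "\<dots> \<le> (fdot y a u)\<^sup>2 / (F y a u)\<^sup>2 * F y a u"
  proof -
    have "0 \<le> (fdot y a u)\<^sup>2 / (F y a u)\<^sup>2 * F y a u" using pos by simp
    then show ?thesis by simp
  qed
  finally have "(sqrt (F y a t) - sqrt (F y a \<theta>\<^sub>0))\<^sup>2 / (t - \<theta>\<^sub>0)\<^sup>2 \<le> (fdot y a u)\<^sup>2 / (F y a u)\<^sup>2 * F y a u" .
  moreover have "bdry m a u \<le> y"
    using bdry_mono[OF near t(1) _ a] u y by (auto simp: supp_def)
  ultimately show ?thesis using near by blast
qed

text \<open>
  Above the boundary at \<open>t\<close>, the Hellinger distance between the densities at \<open>t\<close> and \<open>\<theta>\<^sub>0\<close> is at
  most of order \<open>\<bar>t - \<theta>\<^sub>0\<bar>\<close>, as in a regular model. For \<open>t - \<theta>\<^sub>0 = h/n\<close> its square is \<open>O(1/n\<^sup>2)\<close> and vanishes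
  even after summation over \<open>n\<close> observations: only the moving support is visible in the limit.
\<close>

lemma hellinger_bound:
  assumes t: "\<bar>t - \<theta>\<^sub>0\<bar> < \<eta>" "\<theta>\<^sub>0 < t"
  shows "(\<integral>z. (sqrt (ratio t z) - indicator (above t) z)\<^sup>2 \<partial>Q \<theta>\<^sub>0)
     \<le> (t - \<theta>\<^sub>0)\<^sup>2 * (\<Sum>a\<in>Xset m. px m a * enn2real (score_bound a))"
proof -
  let ?u = "\<lambda>z. (sqrt (ratio t z) - indicator (above t) z)\<^sup>2 / (t - \<theta>\<^sub>0)\<^sup>2"
  let ?K = "\<Sum>a\<in>Xset m. px m a * enn2real (score_bound a)"
  have u: "(\<lambda>z. ennreal (?u z)) \<in> borel_measurable obs_space"
  proof -
    have [measurable]: "ratio t \<in> borel_measurable obs_space" using ratio_measurable[of t] t by simp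
    show ?thesis by measurable
  qed
  have "(\<integral>\<^sup>+z. ennreal (?u z) \<partial>Q \<theta>\<^sub>0) = (\<Sum>a\<in>Xset m. ennreal (px m a) *
      (\<integral>\<^sup>+y. ennreal (?u (y, a)) * (ennreal (F y a \<theta>\<^sub>0) * indicator (supp m a \<theta>\<^sub>0) y) \<partial>lborel))"
    by (rule nn_integral_obs_law[OF base_near u])
  also have "\<dots> \<le> (\<Sum>a\<in>Xset m. ennreal (px m a) * score_bound a)"
  proof (intro sum_mono mult_left_mono)
    fix a assume a: "a \<in> Xset m"
    show "(\<integral>\<^sup>+y. ennreal (?u (y, a)) * (ennreal (F y a \<theta>\<^sub>0) * indicator (supp m a \<theta>\<^sub>0) y) \<partial>lborel) \<le> score_bound a"
      unfolding score_bound_def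
    proof (rule nn_integral_mono)
      fix y
      show "ennreal (?u (y, a)) * (ennreal (F y a \<theta>\<^sub>0) * indicator (supp m a \<theta>\<^sub>0) y)
        \<le> (SUP \<theta>\<in>{\<theta>. \<bar>\<theta> - \<theta>\<^sub>0\<bar> < \<eta>}. ennreal
             ((fdot y a \<theta>)\<^sup>2 / (F y a \<theta>)\<^sup>2 * indicator {bdry m a \<theta>..} y * F y a \<theta>)) * indicator (Yset m) y"
      proof (cases "y \<in> supp m a t")
        case True
        then have y0: "y \<in> supp m a \<theta>\<^sub>0" and Y: "y \<in> Yset m" and ab: "(y, a) \<in> above t"
          using supp_antimono[OF t(1) _ a] t(2) a by (auto simp: supp_def above_def space_pair_measure)
        obtain \<theta> where \<theta>: "\<bar>\<theta> - \<theta>\<^sub>0\<bar> < \<eta>" "bdry m a \<theta> \<le> y"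
          and le: "(sqrt (F y a t) - sqrt (F y a \<theta>\<^sub>0))\<^sup>2 / (t - \<theta>\<^sub>0)\<^sup>2 \<le> (fdot y a \<theta>)\<^sup>2 / (F y a \<theta>)\<^sup>2 * F y a \<theta>"
          using sqrt_dens_increment[OF t a True] by blast
        have p: "F y a \<theta>\<^sub>0 > 0" "F y a t > 0"
          using dens_pos[OF base_near a Y] dens_pos[OF t(1) a Y] by auto
        have "sqrt (F y a t / F y a \<theta>\<^sub>0) - 1 = (sqrt (F y a t) - sqrt (F y a \<theta>\<^sub>0)) / sqrt (F y a \<theta>\<^sub>0)"
          using p by (simp add: real_sqrt_divide diff_divide_distrib)
        then have "(sqrt (F y a t / F y a \<theta>\<^sub>0) - 1)\<^sup>2 * F y a \<theta>\<^sub>0 = (sqrt (F y a t) - sqrt (F y a \<theta>\<^sub>0))\<^sup>2"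
          using p by (simp add: power_divide)
        moreover have "ratio t (y, a) = F y a t / F y a \<theta>\<^sub>0" using True a by (simp add: ratio_def)
        ultimately have "?u (y, a) * F y a \<theta>\<^sub>0 = (sqrt (F y a t) - sqrt (F y a \<theta>\<^sub>0))\<^sup>2 / (t - \<theta>\<^sub>0)\<^sup>2"
          using ab by simp
        then have "ennreal (?u (y, a)) * ennreal (F y a \<theta>\<^sub>0)
            = ennreal ((sqrt (F y a t) - sqrt (F y a \<theta>\<^sub>0))\<^sup>2 / (t - \<theta>\<^sub>0)\<^sup>2)"
          using p by (subst ennreal_mult[symmetric]) auto
        also have "\<dots> \<le> ennreal ((fdot y a \<theta>)\<^sup>2 / (F y a \<theta>)\<^sup>2 * indicator {bdry m a \<theta>..} y * F y a \<theta>)"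
          using le \<theta>(2) by (intro ennreal_leI) simp
        also have "\<dots> \<le> (SUP \<theta>\<in>{\<theta>. \<bar>\<theta> - \<theta>\<^sub>0\<bar> < \<eta>}. ennreal
             ((fdot y a \<theta>)\<^sup>2 / (F y a \<theta>)\<^sup>2 * indicator {bdry m a \<theta>..} y * F y a \<theta>))"
          using \<theta>(1) by (intro SUP_upper) simp
        finally show ?thesis using y0 Y by simp
      next
        case False
        then have "y \<notin> supp m a \<theta>\<^sub>0 \<or> (y, a) \<notin> above t" by (auto simp: supp_def above_def)
        moreover have "ratio t (y, a) = 0" using False by (simp add: ratio_def)
        ultimately show ?thesis by auto
      qed
    qed
  qed auto
  also have "\<dots> = (\<Sum>a\<in>Xset m. ennreal (px m a * enn2real (score_bound a)))"
    using score_integrable px_pos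
    by (intro sum.cong refl) (simp add: score_bound_def ennreal_mult'' less_imp_le)
  also have "\<dots> = ennreal ?K" using px_pos by (intro sum_ennreal) (simp add: less_imp_le)
  finally have "(\<integral>z. ?u z \<partial>Q \<theta>\<^sub>0) \<le> ?K"
    using px_pos by (intro integral_real_bounded sum_nonneg) (auto simp: less_imp_le)
  then show ?thesis using t(2) by (simp add: divide_le_eq mult.commute)
qed

section \<open>Power functions under local alternatives\<close>

lemma sets_local_law: "sets (local_law m \<theta>\<^sub>0 \<gamma> h n) = sets (sample_space m n)"
  unfolding local_law_def sample_law_def sample_space_def
  by (intro sets_PiM_cong refl sets_obs_law)

lemma space_local_law: "space (local_law m \<theta>\<^sub>0 \<gamma> h n) = space (sample_space m n)"
  by (rule sets_eq_imp_space_eq[OF sets_local_law])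

lemma borel_measurable_local_law:
  "borel_measurable (local_law m \<theta>\<^sub>0 \<gamma> h n) = borel_measurable (sample_space m n)"
  by (intro measurable_cong_sets sets_local_law refl)

lemma prob_space_local_law:
  assumes "\<bar>\<theta>\<^sub>0 + h / real n - \<theta>\<^sub>0\<bar> < \<eta>"
  shows "prob_space (local_law m \<theta>\<^sub>0 \<gamma> h n)"
  unfolding local_law_def sample_law_def using prob_space_obs_law[OF assms] by (intro prob_space_PiM)

definition all_above :: "real \<Rightarrow> nat \<Rightarrow> (nat \<Rightarrow> real \<times> 'x) set" where
  "all_above k n = {z \<in> space (sample_space m n). \<forall>i\<in>{..<n}. z i \<in> above (\<theta>\<^sub>0 + k / real n)}"

lemma all_above_measurable: "all_above k n \<in> sets (sample_space m n)"
proof -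
  have "{z \<in> space (sample_space m n). z i \<in> above (\<theta>\<^sub>0 + k / real n)} \<in> sets (sample_space m n)" if "i \<in> {..<n}" for i
  proof -
    have "(\<lambda>z. z i) \<in> measurable (sample_space m n) obs_space"
      unfolding sample_space_def using that by (rule measurable_component_singleton)
    from measurable_sets[OF this above_measurable[of "\<theta>\<^sub>0 + k / real n"]] show ?thesis
      by (simp only: vimage_def Int_def mem_Collect_eq conj_commute)
  qed
  then show ?thesis unfolding all_above_def by (intro sets.sets_Collect_finite_All) auto
qed

lemma prob_all_above:
  assumes "\<bar>\<theta>\<^sub>0 + h / real n - \<theta>\<^sub>0\<bar> < \<eta>"
  shows "measure (local_law m \<theta>\<^sub>0 \<gamma> h n) (all_above k n)
     = measure (Q (\<theta>\<^sub>0 + h / real n)) (above (\<theta>\<^sub>0 + k / real n)) ^ n"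
proof -
  let ?Q = "Q (\<theta>\<^sub>0 + h / real n)" and ?A = "above (\<theta>\<^sub>0 + k / real n)"
  interpret Q: prob_space ?Q by (rule prob_space_obs_law[OF assms])
  interpret P: product_prob_space "\<lambda>_. ?Q" "{..<n}" by standard
  have "all_above k n = {z \<in> space (PiM {..<n} (\<lambda>_. ?Q)). \<forall>i\<in>{..<n}. z i \<in> ?A}"
    using space_local_law[of h n] by (simp add: all_above_def local_law_def sample_law_def)
  then have "emeasure (local_law m \<theta>\<^sub>0 \<gamma> h n) (all_above k n) = (\<Prod>i\<in>{..<n}. emeasure ?Q ?A)"
    unfolding local_law_def sample_law_def
    by (simp only:) (intro P.emeasure_PiM_Collect; simp add: sets_obs_law)
  also have "\<dots> = ennreal (measure ?Q ?A ^ n)"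
    by (simp add: Q.emeasure_eq_measure ennreal_power)
  finally show ?thesis by (simp add: measure_def)
qed

lemma prob_all_above_limit:
  "(\<lambda>n. measure (local_law m \<theta>\<^sub>0 \<gamma> h n) (all_above k n)) \<longlonglongrightarrow> exp (- (rate * max 0 (k - h)))"
proof (rule Lim_transform_eventually[OF tendsto_power_exp[OF mass_below_boundary]])
  show "\<forall>\<^sub>F n in sequentially. measure (Q (\<theta>\<^sub>0 + h / real n)) (above (\<theta>\<^sub>0 + k / real n)) ^ n
      = measure (local_law m \<theta>\<^sub>0 \<gamma> h n) (all_above k n)"
    using eventually_local[OF eta_pos, of h] by eventually_elim (simp add: prob_all_above)
qed

text \<open>
  The likelihood ratio against \<open>h = 0\<close> is asymptotically at most \<open>exp (rate * h)\<close>, so the power exceeds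
  the size by at most this factor in the limit. The parameter \<open>e\<close> of \<open>product_test_bound\<close> is kept
  fixed while \<open>n\<close> grows, and only then made small.
\<close>

lemma power_envelope:
  assumes h: "h > 0" and \<psi>: "\<And>n. is_test m n (\<psi> n)" and \<alpha>: "\<alpha> < 1"
    and level: "limsup (rejection_prob m \<theta>\<^sub>0 \<gamma> \<psi> 0) \<le> ereal \<alpha>"
  shows "limsup (rejection_prob m \<theta>\<^sub>0 \<gamma> \<psi> h) \<le> ereal (exp (rate * h) * \<alpha>)"
proof -
  let ?c = "exp (rate * h)" and ?t = "\<lambda>n. \<theta>\<^sub>0 + h / real n"
  let ?E = "\<lambda>h n. \<integral>z. \<psi> n z \<partial>local_law m \<theta>\<^sub>0 \<gamma> h n"
  define K where "K = (\<Sum>a\<in>Xset m. px m a * enn2real (score_bound a))"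
  define A where "A n = measure (Q \<theta>\<^sub>0) (above (?t n))" for n
  define H where "H n = (\<integral>z. (sqrt (ratio (?t n) z) - indicator (above (?t n)) z)\<^sup>2 \<partial>Q \<theta>\<^sub>0)" for n
  define B where "B n = 1 + ?c * A n ^ n - 2 * sqrt ?c * ((1 + A n - H n) / 2) ^ n" for n
  have nA: "(\<lambda>n. real n * (1 - A n)) \<longlonglongrightarrow> rate * h"
    using mass_below_boundary[of 0 h] h by (simp add: A_def)
  have H_le: "\<forall>\<^sub>F n in sequentially. norm (real n * H n) \<le> h\<^sup>2 * K * inverse (real n)"
    using eventually_local[OF eta_pos, of h] eventually_gt_at_top[of 0]
  proof eventually_elim
    case (elim n)
    have "0 \<le> H n" unfolding H_def by (rule Bochner_Integration.integral_nonneg) simp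
    moreover have "H n \<le> (h / real n)\<^sup>2 * K"
      using hellinger_bound[of "?t n"] elim h by (simp add: H_def K_def)
    then have "real n * H n \<le> real n * ((h / real n)\<^sup>2 * K)" by (rule mult_left_mono) simp
    moreover have "real n * ((h / real n)\<^sup>2 * K) = h\<^sup>2 * K * inverse (real n)"
      using elim by (simp add: power2_eq_square field_simps)
    ultimately show ?case by simp
  qed
  have "(\<lambda>n. h\<^sup>2 * K * inverse (real n)) \<longlonglongrightarrow> h\<^sup>2 * K * 0"
    by (intro tendsto_mult tendsto_const lim_inverse_n)
  with H_le have nH: "(\<lambda>n. real n * H n) \<longlonglongrightarrow> 0"
    by (auto intro: Lim_null_comparison)
  have "(\<lambda>n. (real n * (1 - A n) + real n * H n) / 2) \<longlonglongrightarrow> (rate * h + 0) / 2"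
    by (intro tendsto_intros nA nH) simp
  then have nb: "(\<lambda>n. real n * (1 - (1 + A n - H n) / 2)) \<longlonglongrightarrow> rate * h / 2"
    by (simp add: field_simps)
  have sq: "sqrt ?c = exp (rate * h / 2)"
    by (rule real_sqrt_unique) (simp_all add: power2_eq_square exp_add[symmetric])
  have "B \<longlonglongrightarrow> 1 + ?c * exp (- (rate * h)) - 2 * sqrt ?c * exp (- (rate * h / 2))"
    unfolding B_def by (intro tendsto_intros tendsto_power_exp nA nb)
  also have "1 + ?c * exp (- (rate * h)) - 2 * sqrt ?c * exp (- (rate * h / 2)) = 0"
    unfolding sq by (simp add: exp_add[symmetric] mult.assoc)
  finally have B0: "B \<longlonglongrightarrow> 0" .
  have bound: "\<forall>\<^sub>F n in sequentially. ?E h n \<le> (1 + e) * ?c * ?E 0 n + (1 + 1 / e) * B n" if e: "e > 0" for e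
    using eventually_local[OF eta_pos, of h] eventually_gt_at_top[of 0]
  proof eventually_elim
    case (elim n)
    let ?r = "ratio (?t n)"
    have t: "\<bar>?t n - \<theta>\<^sub>0\<bar> < \<eta>" "\<theta>\<^sub>0 \<le> ?t n" using elim h by auto
    have sets: "sets (PiM {..<n} (\<lambda>_. Q \<theta>\<^sub>0)) = sets (sample_space m n)"
      using sets_local_law[of 0 n] by (simp add: local_law_def sample_law_def)
    have eq: "density (Q \<theta>\<^sub>0) (\<lambda>z. ennreal (?r z)) = Q (?t n)" by (rule obs_law_density_ratio[OF t, symmetric])
    have "(\<integral>z. \<psi> n z \<partial>PiM {..<n} (\<lambda>_. density (Q \<theta>\<^sub>0) (\<lambda>z. ennreal (?r z))))
      \<le> (1 + e) * ?c * (\<integral>z. \<psi> n z \<partial>PiM {..<n} (\<lambda>_. Q \<theta>\<^sub>0)) + (1 + 1 / e) *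
        (1 + ?c * measure (Q \<theta>\<^sub>0) (above (?t n)) ^ card {..<n}
           - 2 * sqrt ?c * ((1 + measure (Q \<theta>\<^sub>0) (above (?t n)) - H n) / 2) ^ card {..<n})"
    proof (rule product_test_bound)
      show "prob_space (Q \<theta>\<^sub>0)" by (rule prob_space_obs_law[OF base_near])
      show "prob_space (density (Q \<theta>\<^sub>0) (\<lambda>z. ennreal (?r z)))" unfolding eq by (rule prob_space_obs_law[OF t(1)])
      show "?r \<in> borel_measurable (Q \<theta>\<^sub>0)"
        using ratio_measurable[OF t] measurable_cong_sets[OF sets_obs_law refl] by blast
      show "?r z \<ge> 0" for z by (rule ratio_nonneg[OF t(1)])
      show "above (?t n) \<in> sets (Q \<theta>\<^sub>0)" by (simp add: sets_obs_law)
      show "?r z = 0" if "z \<notin> above (?t n)" for z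
        using that by (cases z) (auto simp: above_def ratio_def supp_def space_pair_measure)
      show "\<psi> n \<in> borel_measurable (PiM {..<n} (\<lambda>_. Q \<theta>\<^sub>0))"
        using \<psi>[of n] measurable_cong_sets[OF sets refl] unfolding is_test_def by blast
      show "0 \<le> \<psi> n z \<and> \<psi> n z \<le> 1" if "z \<in> space (PiM {..<n} (\<lambda>_. Q \<theta>\<^sub>0))" for z
        using \<psi>[of n] that unfolding is_test_def sets_eq_imp_space_eq[OF sets] by blast
    qed (use e in \<open>auto simp: H_def\<close>)
    then show ?case unfolding eq by (simp add: local_law_def sample_law_def B_def A_def)
  qed
  have "\<forall>\<^sub>F n in sequentially. ?E h n < ?c * \<alpha> + d" if d: "d > 0" for d
  proof -
    \<comment> \<open>With \<open>e \<le> 1\<close> and \<open>\<alpha> < 1\<close>, \<open>(1 + e) * c * (\<alpha> + e) \<le> c * \<alpha> + 3 * c * e\<close>, so this \<open>e\<close> costs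
      at most \<open>d / 2\<close>.\<close>
    define e where "e = min 1 (d / (6 * ?c))"
    have e: "e > 0" "e \<le> 1" "e \<le> d / (6 * ?c)" using d by (auto simp: e_def)
    have "(\<lambda>n. (1 + 1 / e) * B n) \<longlonglongrightarrow> (1 + 1 / e) * 0" by (intro tendsto_intros B0)
    then have "\<forall>\<^sub>F n in sequentially. (1 + 1 / e) * B n < d / 2"
      by (rule order_tendstoD) (use d in simp)
    moreover have "\<forall>\<^sub>F n in sequentially. ?E 0 n < \<alpha> + e"
      using level e(1) unfolding rejection_prob_def limsup_ereal_le_iff by blast
    ultimately show ?thesis using bound[OF e(1)]
    proof eventually_elim
      case (elim n)
      have "(1 + e) * ?c * ?E 0 n \<le> (1 + e) * ?c * (\<alpha> + e)"
        using elim e by (intro mult_left_mono) auto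
      also have "\<dots> = ?c * \<alpha> + (?c * e) * (1 + \<alpha> + e)" by (simp add: algebra_simps)
      also have "\<dots> \<le> ?c * \<alpha> + (?c * e) * 3"
        using e \<alpha> by (intro add_left_mono mult_left_mono) auto
      also have "\<dots> \<le> ?c * \<alpha> + d / 2"
        using e(3) by (simp add: field_simps)
      finally show ?case using elim by linarith
    qed
  qed
  then show ?thesis unfolding rejection_prob_def limsup_ereal_le_iff by blast
qed

text \<open>
  The boundaries are increasing in the parameter, so on the event \<open>\<bar>hhat - hbar\<bar> \<le> \<delta>\<close> the test is
  squeezed between the indicators of \<open>all_above (hbar + 2 * \<delta>)\<close> and \<open>all_above (hbar - \<delta>)\<close>. Their
  probabilities have limits that are continuous in the parameter.
\<close>

lemma phi_minus_power:
  assumes test: "\<And>n. is_test m n (phi_minus m \<theta>\<^sub>0 dflt hhat n)"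
    and hh: "\<And>n. hhat n \<in> borel_measurable (sample_space m n)"
    and bd: "bounded_in_prob (local_law m \<theta>\<^sub>0 \<gamma> h) (\<lambda>n z. sqrt (real n) * (hhat n z - hbar))"
  shows "(\<lambda>n. \<integral>z. phi_minus m \<theta>\<^sub>0 dflt hhat n z \<partial>local_law m \<theta>\<^sub>0 \<gamma> h n)
     \<longlonglongrightarrow> exp (- (rate * max 0 (hbar - h)))"
proof (rule tendstoI)
  let ?P = "local_law m \<theta>\<^sub>0 \<gamma> h" and ?\<phi> = "phi_minus m \<theta>\<^sub>0 dflt hhat"
  let ?L = "\<lambda>k. exp (- (rate * max 0 (k - h)))"
  fix e :: real assume e: "e > 0"
  have "isCont ?L hbar" by (intro continuous_intros)
  then obtain d where d: "d > 0" and Ld: "\<And>k. \<bar>k - hbar\<bar> < d \<Longrightarrow> \<bar>?L k - ?L hbar\<bar> < e / 3"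
    using e unfolding continuous_at_eps_delta dist_real_def by (metis zero_less_divide_iff zero_less_numeral)
  define \<delta> where "\<delta> = d / 3"
  have \<delta>: "\<delta> > 0" "2 * \<delta> < d" using d by (auto simp: \<delta>_def)
  define dev where "dev n = {z \<in> space (?P n). \<bar>hhat n z - hbar\<bar> > \<delta>}" for n
  have ev_prob: "\<forall>\<^sub>F n in sequentially. prob_space (?P n)"
    using eventually_local[OF eta_pos, of h] by eventually_elim (rule prob_space_local_law)
  have dev0: "(\<lambda>n. measure (?P n) (dev n)) \<longlonglongrightarrow> 0"
    unfolding dev_def
  proof (rule bounded_in_prob_deviation[OF bd _ \<delta>(1)])
    show "\<forall>\<^sub>F n in sequentially. finite_measure (?P n) \<and> hhat n \<in> borel_measurable (?P n)"
      using ev_prob by eventually_elim (simp add: prob_space.axioms(1) borel_measurable_local_law hh)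
  qed
  have close: "\<forall>\<^sub>F n in sequentially. \<bar>measure (?P n) (all_above k n) - ?L k\<bar> < e / 3" for k
    using tendstoD[OF prob_all_above_limit[of h k], of "e / 3"] e by (simp add: dist_real_def)
  have dev_small: "\<forall>\<^sub>F n in sequentially. measure (?P n) (dev n) < e / 3"
    using e by (intro order_tendstoD(2)[OF dev0]) simp
  show "\<forall>\<^sub>F n in sequentially. dist (\<integral>z. ?\<phi> n z \<partial>?P n) (?L hbar) < e"
    using close[of "hbar - \<delta>"] close[of "hbar + 2 * \<delta>"] dev_small ev_prob
      eventually_local[OF eta_pos, of "hbar - \<delta>"] eventually_local[OF eta_pos, of "hbar + 2 * \<delta>"]
      eventually_gt_at_top[of 0]
  proof (eventually_elim)
    case (elim n)
    interpret prob_space "?P n" by fact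
    let ?lo = "\<theta>\<^sub>0 + (hbar - \<delta>) / real n" and ?hi = "\<theta>\<^sub>0 + (hbar + 2 * \<delta>) / real n"
    have [measurable]: "hhat n \<in> borel_measurable (?P n)" by (simp add: borel_measurable_local_law hh)
    have meas: "all_above k n \<in> sets (?P n)" "dev n \<in> sets (?P n)" for k
      by (simp add: sets_local_law all_above_measurable) (unfold dev_def, measurable)
    have \<phi>01: "0 \<le> ?\<phi> n z" "?\<phi> n z \<le> 1" if "z \<in> space (?P n)" for z
      using test[of n] that unfolding is_test_def space_local_law by auto
    have i\<phi>: "integrable (?P n) (?\<phi> n)"
      using test[of n] \<phi>01 by (intro integrable_const_bound[where B=1])
         (auto simp: is_test_def borel_measurable_local_law)
    have ii: "integrable (?P n) (indicator S :: _ \<Rightarrow> real)" if "S \<in> sets (?P n)" for S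
      using that by (intro integrable_const_bound[where B=1]) (auto simp: indicator_def)
    \<comment> \<open>The factor 2 in the upper parameter leaves room for the strict inequality in the test.\<close>
    have sandwich: "indicator (all_above (hbar + 2 * \<delta>) n) z - indicator (dev n) z \<le> ?\<phi> n z \<and>
        ?\<phi> n z \<le> indicator (all_above (hbar - \<delta>) n) z + (indicator (dev n) z :: real)"
      if z: "z \<in> space (?P n)" for z
    proof (cases "z \<in> dev n")
      case True
      then show ?thesis using \<phi>01[OF z] by (auto simp: indicator_def)
    next
      case False
      let ?t = "\<theta>\<^sub>0 + hhat n z / real n"
      have hz: "hbar - \<delta> \<le> hhat n z" "hhat n z < hbar + 2 * \<delta>"
        using False z \<delta>(1) by (auto simp: dev_def)
      have le: "?lo \<le> ?t" "?t < ?hi"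
        using hz elim(7) by (auto intro: divide_right_mono divide_strict_right_mono)
      have near: "\<bar>?t - \<theta>\<^sub>0\<bar> < \<eta>" using le elim(5,6) by (auto simp only: abs_less_iff)
      have zi: "snd (z i) \<in> Xset m" "z i \<in> space obs_space" if "i < n" for i
      proof -
        show "z i \<in> space obs_space"
          using z that unfolding space_local_law sample_space_def space_PiM by auto
        then show "snd (z i) \<in> Xset m" by (auto simp: space_pair_measure)
      qed
      have \<phi>: "?\<phi> n z = (if \<forall>i<n. bdry m (snd (z i)) ?t < fst (z i) then 1 else 0)"
        using Theta_near[OF near] by (simp add: phi_minus_def)
      have hi: "\<forall>i<n. bdry m (snd (z i)) ?t < fst (z i)" if "z \<in> all_above (hbar + 2 * \<delta>) n"
      proof (intro allI impI)
        fix i assume "i < n"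
        with that have "bdry m (snd (z i)) ?hi \<le> fst (z i)" by (auto simp: all_above_def above_def)
        with bdry_strict_mono[OF near elim(6) le(2) zi(1)[OF \<open>i < n\<close>]]
        show "bdry m (snd (z i)) ?t < fst (z i)" by linarith
      qed
      have lo: "z \<in> all_above (hbar - \<delta>) n" if *: "\<forall>i<n. bdry m (snd (z i)) ?t < fst (z i)"
      proof -
        have "bdry m (snd (z i)) ?lo \<le> fst (z i)" if "i < n" for i
          using bdry_mono[OF elim(5) near le(1) zi(1)[OF that]] *[rule_format, OF that] by linarith
        with zi(2) z show ?thesis by (auto simp: all_above_def above_def space_local_law)
      qed
      show ?thesis using False hi lo by (auto simp: \<phi> indicator_def)
    qed
    have "(\<integral>z. indicator (all_above (hbar + 2 * \<delta>) n) z - indicator (dev n) z \<partial>?P n) \<le> (\<integral>z. ?\<phi> n z \<partial>?P n)"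
      using sandwich by (intro integral_mono i\<phi> Bochner_Integration.integrable_diff ii meas) auto
    then have low: "measure (?P n) (all_above (hbar + 2 * \<delta>) n) - measure (?P n) (dev n) \<le> (\<integral>z. ?\<phi> n z \<partial>?P n)"
      by (simp add: ii meas Bochner_Integration.integral_diff)
    have "(\<integral>z. ?\<phi> n z \<partial>?P n) \<le> (\<integral>z. indicator (all_above (hbar - \<delta>) n) z + indicator (dev n) z \<partial>?P n)"
      using sandwich by (intro integral_mono i\<phi> Bochner_Integration.integrable_add ii meas) auto
    then have up: "(\<integral>z. ?\<phi> n z \<partial>?P n) \<le> measure (?P n) (all_above (hbar - \<delta>) n) + measure (?P n) (dev n)"
      by (simp add: ii meas Bochner_Integration.integral_add)
    have "\<bar>?L (hbar - \<delta>) - ?L hbar\<bar> < e / 3" "\<bar>?L (hbar + 2 * \<delta>) - ?L hbar\<bar> < e / 3"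
      using \<delta> Ld[of "hbar - \<delta>"] Ld[of "hbar + 2 * \<delta>"] by (simp_all only: abs_less_iff) linarith+
    with low up elim(1,2,3) show ?case unfolding dist_real_def abs_less_iff by linarith
  qed
qed

lemma limsup_rejection_prob_le_1:
  assumes \<psi>: "\<And>n. is_test m n (\<psi> n)"
  shows "limsup (rejection_prob m \<theta>\<^sub>0 \<gamma> \<psi> h) \<le> ereal 1"
proof (rule Limsup_bounded)
  show "\<forall>\<^sub>F n in sequentially. rejection_prob m \<theta>\<^sub>0 \<gamma> \<psi> h n \<le> ereal 1"
    using eventually_local[OF eta_pos, of h]
  proof eventually_elim
    case (elim n)
    interpret prob_space "local_law m \<theta>\<^sub>0 \<gamma> h n" by (rule prob_space_local_law[OF elim])
    have "AE z in local_law m \<theta>\<^sub>0 \<gamma> h n. \<psi> n z \<le> 1"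
      using \<psi>[of n] by (intro AE_I2) (simp add: is_test_def space_local_law)
    moreover have "integrable (local_law m \<theta>\<^sub>0 \<gamma> h n) (\<psi> n)"
      using \<psi>[of n] by (intro integrable_const_bound[where B=1] AE_I2)
         (auto simp: is_test_def borel_measurable_local_law space_local_law)
    ultimately have "expectation (\<psi> n) \<le> 1" by (intro integral_le_const)
    then show ?case by (simp add: rejection_prob_def)
  qed
qed

lemma rate_pos: "rate > 0"
proof -
  have ne: "Xset m \<noteq> {}" using px_sum by auto
  have "F (bdry m a \<theta>\<^sub>0) a \<theta>\<^sub>0 > 0" if "a \<in> Xset m" for a
    using dens_pos[OF base_near that] bdry_interior[OF that] interior_subset by blast
  then show ?thesis unfolding rate_def
    by (intro sum_pos finite_X ne mult_pos_pos px_pos bdry_deriv_pos base_near)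
qed

lemma rate_eq: "(\<integral>x. F (bdry m x \<theta>\<^sub>0) x \<theta>\<^sub>0 * g' x \<theta>\<^sub>0 \<partial>X_law m) = rate"
  unfolding X_law_def rate_def
  using px_pos by (subst lebesgue_integral_point_measure_finite) (auto simp: finite_X less_imp_le)

end

section \<open>The plug-in test\<close>

text \<open>
  Measurability is the only issue: the boundary is evaluated at a random parameter, and it is only known
  to be continuous on the parameter set. It is extended by 0 off that set and written as a finite sum
  over the values of the covariate.
\<close>

lemma phi_minus_is_test:
  fixes m :: "('x::euclidean_space, 'g::euclidean_space) boundary_model"
  assumes fin: "finite (Xset m)" and \<Theta>[measurable]: "Theta_set m \<in> sets borel"
    and cont: "\<And>a. a \<in> Xset m \<Longrightarrow> continuous_on (Theta_set m) (bdry m a)"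
    and hh[measurable]: "hhat n \<in> borel_measurable (sample_space m n)"
    and dflt: "is_test m n (dflt n)"
  shows "is_test m n (phi_minus m \<theta>\<^sub>0 dflt hhat n)"
proof -
  let ?S = "sample_space m n"
  let ?t = "\<lambda>z. \<theta>\<^sub>0 + hhat n z / real n"
  have [measurable]: "dflt n \<in> borel_measurable ?S" using dflt by (simp add: is_test_def)
  define b where "b a \<theta> = indicator (Theta_set m) \<theta> *\<^sub>R bdry m a \<theta>" for a \<theta>
  have b: "b a \<in> borel_measurable borel" if "a \<in> Xset m" for a
    unfolding b_def by (intro borel_measurable_continuous_on_indicator \<Theta> cont that)
  define B where "B i z = (\<Sum>a\<in>Xset m. indicator {a} (snd (z i)) * b a (?t z))" for i and z :: "nat \<Rightarrow> real \<times> 'x"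
  have comp: "(\<lambda>z. z i) \<in> measurable ?S (borel \<Otimes>\<^sub>M count_space (Xset m))" if "i < n" for i
    unfolding sample_space_def using that by (intro measurable_component_singleton) auto
  have [measurable]: "(\<lambda>z. fst (z i)) \<in> borel_measurable ?S" if "i < n" for i
    using comp[OF that] by measurable
  have [measurable]: "B i \<in> borel_measurable ?S" if "i < n" for i
  proof -
    have "(\<lambda>z. b a (?t z)) \<in> borel_measurable ?S" if "a \<in> Xset m" for a
      using b[OF that] by measurable
    moreover have "(\<lambda>z. indicator {a} (snd (z i)) :: real) \<in> borel_measurable ?S" for a
    proof -
      have "(\<lambda>z. snd (z i)) \<in> measurable ?S (count_space (Xset m))" using comp[OF \<open>i < n\<close>] by measurable
      from measurable_compose[OF this, of "indicator {a}" borel] show ?thesis by simp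
    qed
    ultimately show ?thesis unfolding B_def by measurable
  qed
  have "(\<lambda>z. if ?t z \<in> Theta_set m then (if \<forall>i\<in>{..<n}. B i z < fst (z i) then 1 else 0) else dflt n z)
      \<in> borel_measurable ?S"
    by measurable
  also have "?this \<longleftrightarrow> phi_minus m \<theta>\<^sub>0 dflt hhat n \<in> borel_measurable ?S"
  proof (rule measurable_cong)
    fix z assume z: "z \<in> space ?S"
    have "B i z = bdry m (snd (z i)) (?t z)" if "i < n" "?t z \<in> Theta_set m" for i
    proof -
      have "snd (z i) \<in> Xset m" using measurable_space[OF comp[OF that(1)] z] by (auto simp: space_pair_measure)
      then show ?thesis using that(2) fin
        by (simp add: B_def b_def indicator_def if_distrib[of "\<lambda>u. u * _"] sum.delta' cong: if_cong)
    qed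
    then show "(if ?t z \<in> Theta_set m then (if \<forall>i\<in>{..<n}. B i z < fst (z i) then 1 else 0) else dflt n z)
        = phi_minus m \<theta>\<^sub>0 dflt hhat n z"
      by (auto simp: phi_minus_def Let_def)
  qed
  finally show ?thesis
    using dflt by (auto simp: is_test_def phi_minus_def Let_def)
qed

text \<open>
  The radius \<open>\<eta>\<close> is chosen so that the path stays in the neighbourhood of \<open>(\<theta>\<^sub>0, \<gamma>)\<close> where the
  regularity conditions hold and, by continuity of \<open>g'\<close> and finiteness of the covariate set, the
  boundaries are increasing. The partial score is dominated by the norm of the full score, and the
  diagonal \<open>\<beta>' = \<beta>\<close> of the double supremum is all that is kept.
\<close>

lemma assumption_B_regular_boundary_path:
  assumes Bi: "assumption_B_i m H \<theta>\<^sub>0 \<gamma>" and Biii: "assumption_B_iii m f' f'' g' \<theta>\<^sub>0 \<gamma>"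
  shows "\<exists>\<eta> C. regular_boundary_path m \<gamma> \<theta>\<^sub>0 \<eta> C (\<lambda>y a \<theta>. fst (f' y a (\<theta>, \<gamma>))) g'"
proof -
  note i = Bi[unfolded assumption_B_i_def]
  note iii = Biii[unfolded assumption_B_iii_def]
  let ?B = "Theta_set m \<times> Gamma_set m"
  obtain N C where N: "open N" "(\<theta>\<^sub>0, \<gamma>) \<in> N" "N \<subseteq> ?B"
    and reg: "\<And>\<beta> a. \<beta> \<in> N \<Longrightarrow> a \<in> Xset m \<Longrightarrow> continuous_on (Yset m) (\<lambda>y. dens m y a \<beta>)"
      "\<And>\<beta> a y. \<beta> \<in> N \<Longrightarrow> a \<in> Xset m \<Longrightarrow> y \<in> Yset m \<Longrightarrow> 0 < dens m y a \<beta> \<and> norm (f' y a \<beta>) < C"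
    and score: "\<And>a. a \<in> Xset m \<Longrightarrow> (\<integral>\<^sup>+y\<in>Yset m. (SUP (\<beta>', \<beta>)\<in>N \<times> N. ennreal
               ((norm (f' y a \<beta>'))\<^sup>2 / (dens m y a \<beta>')\<^sup>2
                 * indicator {bdry m a (fst \<beta>)..} y * dens m y a \<beta>)) \<partial>lborel) < \<infinity>"
    and g0: "\<And>a. a \<in> Xset m \<Longrightarrow> g' a \<theta>\<^sub>0 > 0"
    using iii by blast
  have fin: "finite (Xset m)" using i by blast
  have df: "(dens m y a has_derivative (\<lambda>v. f' y a \<beta> \<bullet> v)) (at \<beta> within ?B)"
    if "y \<in> Yset m" "a \<in> Xset m" "\<beta> \<in> ?B" for y a \<beta>
    using iii that by blast
  have dg: "(bdry m a has_real_derivative g' a \<theta>) (at \<theta> within Theta_set m)"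
    and cg: "continuous_on (Theta_set m) (g' a)" if "\<theta> \<in> Theta_set m" "a \<in> Xset m" for a \<theta>
    using iii that by blast+
  obtain r where r: "r > 0" "ball (\<theta>\<^sub>0, \<gamma>) r \<subseteq> N"
    using N(1,2) open_contains_ball by blast
  have inN: "(\<theta>, \<gamma>) \<in> N" if "\<bar>\<theta> - \<theta>\<^sub>0\<bar> < r" for \<theta>
  proof -
    have "dist (\<theta>\<^sub>0, \<gamma>) (\<theta>, \<gamma>) < r" using that by (simp add: dist_Pair_Pair dist_real_def abs_minus_commute)
    then show ?thesis using r(2) by auto
  qed
  have inT: "\<theta> \<in> Theta_set m" if "\<bar>\<theta> - \<theta>\<^sub>0\<bar> < r" for \<theta>
    using inN[OF that] N(3) by auto
  have sub: "ball \<theta>\<^sub>0 r \<subseteq> Theta_set m"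
    using inT by (auto simp: dist_real_def abs_minus_commute)
  have int: "\<theta> \<in> interior (Theta_set m)" if "\<bar>\<theta> - \<theta>\<^sub>0\<bar> < r" for \<theta>
    by (rule interiorI[OF open_ball _ sub]) (use that in \<open>simp add: dist_real_def abs_minus_commute\<close>)
  have "\<forall>a\<in>Xset m. \<forall>\<^sub>F \<theta> in nhds \<theta>\<^sub>0. g' a \<theta> > 0"
  proof
    fix a assume a: "a \<in> Xset m"
    have "isCont (g' a) \<theta>\<^sub>0"
      using cg[OF inT[of \<theta>\<^sub>0] a] int[of \<theta>\<^sub>0] r(1) by (auto intro: continuous_on_interior)
    then have "(g' a \<longlongrightarrow> g' a \<theta>\<^sub>0) (nhds \<theta>\<^sub>0)" by (simp add: isCont_def tendsto_at_iff_tendsto_nhds)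
    from order_tendstoD(1)[OF this g0[OF a]] show "\<forall>\<^sub>F \<theta> in nhds \<theta>\<^sub>0. g' a \<theta> > 0" .
  qed
  then have "\<forall>\<^sub>F \<theta> in nhds \<theta>\<^sub>0. \<forall>a\<in>Xset m. g' a \<theta> > 0"
    using fin by (simp add: eventually_ball_finite_distrib)
  then obtain s where s: "s > 0" "\<And>\<theta> a. \<bar>\<theta> - \<theta>\<^sub>0\<bar> < s \<Longrightarrow> a \<in> Xset m \<Longrightarrow> g' a \<theta> > 0"
    unfolding eventually_nhds_metric dist_real_def by blast
  define \<eta> where "\<eta> = min r s"
  have \<eta>: "\<eta> > 0" and \<eta>r: "\<bar>\<theta> - \<theta>\<^sub>0\<bar> < \<eta> \<Longrightarrow> \<bar>\<theta> - \<theta>\<^sub>0\<bar> < r" and \<eta>s: "\<bar>\<theta> - \<theta>\<^sub>0\<bar> < \<eta> \<Longrightarrow> \<bar>\<theta> - \<theta>\<^sub>0\<bar> < s" for \<theta>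
    using r s by (auto simp: \<eta>_def)
  have "regular_boundary_path m \<gamma> \<theta>\<^sub>0 \<eta> C (\<lambda>y a \<theta>. fst (f' y a (\<theta>, \<gamma>))) g'"
  proof
    show "finite (Xset m)" by (rule fin)
    show "px m a > 0" if "a \<in> Xset m" for a using i that by blast
    show "(\<Sum>a\<in>Xset m. px m a) = 1" using i by blast
    show "Yset m \<in> sets borel" using i by blast
    show "bdry m a \<theta>\<^sub>0 \<in> interior (Yset m)" if "a \<in> Xset m" for a using i that by blast
    show "\<eta> > 0" by (rule \<eta>)
    show "continuous_on (Yset m) (\<lambda>y. dens m y a (\<theta>\<^sub>0, \<gamma>))" if "a \<in> Xset m" for a
      by (rule reg(1)[OF N(2) that])
  next
    fix \<theta> assume \<theta>: "\<bar>\<theta> - \<theta>\<^sub>0\<bar> < \<eta>"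
    show "\<theta> \<in> Theta_set m" by (rule inT[OF \<eta>r[OF \<theta>]])
  next
    fix \<theta> a assume \<theta>: "\<bar>\<theta> - \<theta>\<^sub>0\<bar> < \<eta>" and a: "a \<in> Xset m"
    have "(\<theta>, \<gamma>) \<in> ?B" using inN[OF \<eta>r[OF \<theta>]] N(3) by blast
    then show "set_borel_measurable borel (supp m a \<theta>) (\<lambda>y. dens m y a (\<theta>, \<gamma>))"
      and "(\<integral>\<^sup>+y\<in>supp m a \<theta>. ennreal (dens m y a (\<theta>, \<gamma>)) \<partial>lborel) = 1"
      using i a by fastforce+
    show "(bdry m a has_real_derivative g' a \<theta>) (at \<theta>)"
      using dg[OF inT[OF \<eta>r[OF \<theta>]] a] at_within_interior[OF int[OF \<eta>r[OF \<theta>]]] by simp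
    show "g' a \<theta> > 0" by (rule s(2)[OF \<eta>s[OF \<theta>] a])
  next
    fix \<theta> a y assume \<theta>: "\<bar>\<theta> - \<theta>\<^sub>0\<bar> < \<eta>" and a: "a \<in> Xset m" and y: "y \<in> Yset m"
    let ?\<beta> = "(\<theta>, \<gamma>)"
    have \<beta>: "?\<beta> \<in> N" by (rule inN[OF \<eta>r[OF \<theta>]])
    then have "?\<beta> \<in> interior ?B" using N by (meson interiorI)
    then have "(dens m y a has_derivative (\<lambda>v. f' y a ?\<beta> \<bullet> v)) (at ?\<beta>)"
      using df[OF y a] \<beta> N(3) at_within_interior by (metis subsetD)
    moreover have "((\<lambda>t. (t, \<gamma>)) has_derivative (\<lambda>t. (t, 0))) (at \<theta>)"
      by (auto intro!: derivative_eq_intros)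
    ultimately have "((\<lambda>t. dens m y a (t, \<gamma>)) has_derivative (\<lambda>t. f' y a ?\<beta> \<bullet> (t, 0))) (at \<theta>)"
      by (rule has_derivative_compose[rotated])
    then show "((\<lambda>t. dens m y a (t, \<gamma>)) has_real_derivative fst (f' y a ?\<beta>)) (at \<theta>)"
      by (simp add: has_field_derivative_def inner_prod_def)
    show "dens m y a ?\<beta> > 0" using reg(2)[OF \<beta> a y] by blast
    show "\<bar>fst (f' y a ?\<beta>)\<bar> \<le> C"
      using reg(2)[OF \<beta> a y] norm_fst_le[of "fst (f' y a ?\<beta>)" "snd (f' y a ?\<beta>)"] by simp
  next
    fix a assume a: "a \<in> Xset m"
    have "(\<integral>\<^sup>+y\<in>Yset m. (SUP \<theta>\<in>{\<theta>. \<bar>\<theta> - \<theta>\<^sub>0\<bar> < \<eta>}. ennreal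
             ((fst (f' y a (\<theta>, \<gamma>)))\<^sup>2 / (dens m y a (\<theta>, \<gamma>))\<^sup>2 * indicator {bdry m a \<theta>..} y * dens m y a (\<theta>, \<gamma>))) \<partial>lborel)
       \<le> (\<integral>\<^sup>+y\<in>Yset m. (SUP (\<beta>', \<beta>)\<in>N \<times> N. ennreal
               ((norm (f' y a \<beta>'))\<^sup>2 / (dens m y a \<beta>')\<^sup>2
                 * indicator {bdry m a (fst \<beta>)..} y * dens m y a \<beta>)) \<partial>lborel)"
    proof (rule nn_integral_mono)
      fix y
      show "(SUP \<theta>\<in>{\<theta>. \<bar>\<theta> - \<theta>\<^sub>0\<bar> < \<eta>}. ennreal
             ((fst (f' y a (\<theta>, \<gamma>)))\<^sup>2 / (dens m y a (\<theta>, \<gamma>))\<^sup>2 * indicator {bdry m a \<theta>..} y * dens m y a (\<theta>, \<gamma>))) * indicator (Yset m) y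
       \<le> (SUP (\<beta>', \<beta>)\<in>N \<times> N. ennreal
               ((norm (f' y a \<beta>'))\<^sup>2 / (dens m y a \<beta>')\<^sup>2
                 * indicator {bdry m a (fst \<beta>)..} y * dens m y a \<beta>)) * indicator (Yset m) y"
      proof (cases "y \<in> Yset m")
        case True
        have "(SUP \<theta>\<in>{\<theta>. \<bar>\<theta> - \<theta>\<^sub>0\<bar> < \<eta>}. ennreal
             ((fst (f' y a (\<theta>, \<gamma>)))\<^sup>2 / (dens m y a (\<theta>, \<gamma>))\<^sup>2 * indicator {bdry m a \<theta>..} y * dens m y a (\<theta>, \<gamma>)))
          \<le> (SUP (\<beta>', \<beta>)\<in>N \<times> N. ennreal
               ((norm (f' y a \<beta>'))\<^sup>2 / (dens m y a \<beta>')\<^sup>2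
                 * indicator {bdry m a (fst \<beta>)..} y * dens m y a \<beta>))"
        proof (rule SUP_least)
          fix \<theta> assume "\<theta> \<in> {\<theta>. \<bar>\<theta> - \<theta>\<^sub>0\<bar> < \<eta>}"
          then have \<beta>: "(\<theta>, \<gamma>) \<in> N" using inN \<eta>r by blast
          have "\<bar>fst (f' y a (\<theta>, \<gamma>))\<bar> \<le> norm (f' y a (\<theta>, \<gamma>))"
            using norm_fst_le[of "fst (f' y a (\<theta>, \<gamma>))" "snd (f' y a (\<theta>, \<gamma>))"] by simp
          then have "(fst (f' y a (\<theta>, \<gamma>)))\<^sup>2 \<le> (norm (f' y a (\<theta>, \<gamma>)))\<^sup>2"
            by (metis abs_ge_zero power2_abs power_mono)
          then have "ennreal ((fst (f' y a (\<theta>, \<gamma>)))\<^sup>2 / (dens m y a (\<theta>, \<gamma>))\<^sup>2 * indicator {bdry m a \<theta>..} y * dens m y a (\<theta>, \<gamma>))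
            \<le> ennreal ((norm (f' y a (\<theta>, \<gamma>)))\<^sup>2 / (dens m y a (\<theta>, \<gamma>))\<^sup>2 * indicator {bdry m a \<theta>..} y * dens m y a (\<theta>, \<gamma>))"
            using reg(2)[OF \<beta> a True] by (intro ennreal_leI mult_right_mono divide_right_mono) auto
          also have "\<dots> \<le> (SUP (\<beta>', \<beta>)\<in>N \<times> N. ennreal
               ((norm (f' y a \<beta>'))\<^sup>2 / (dens m y a \<beta>')\<^sup>2
                 * indicator {bdry m a (fst \<beta>)..} y * dens m y a \<beta>))"
            using \<beta> by (intro SUP_upper2[of "((\<theta>, \<gamma>), (\<theta>, \<gamma>))"]) auto
          finally show "ennreal ((fst (f' y a (\<theta>, \<gamma>)))\<^sup>2 / (dens m y a (\<theta>, \<gamma>))\<^sup>2 * indicator {bdry m a \<theta>..} y * dens m y a (\<theta>, \<gamma>)) \<le> \<dots>" .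
        qed
        then show ?thesis by (rule mult_right_mono) simp
      qed simp
    qed
    also have "\<dots> < \<infinity>" by (rule score[OF a])
    finally show "(\<integral>\<^sup>+y\<in>Yset m. (SUP \<theta>\<in>{\<theta>. \<bar>\<theta> - \<theta>\<^sub>0\<bar> < \<eta>}. ennreal
             ((fst (f' y a (\<theta>, \<gamma>)))\<^sup>2 / (dens m y a (\<theta>, \<gamma>))\<^sup>2 * indicator {bdry m a \<theta>..} y * dens m y a (\<theta>, \<gamma>)))
           \<partial>lborel) < \<infinity>" .
  qed
  then show ?thesis by blast
qed

theorem theorem4:
  fixes m :: "('x::euclidean_space, 'g::euclidean_space) boundary_model"
    and f' :: "real \<Rightarrow> 'x \<Rightarrow> real \<times> 'g \<Rightarrow> real \<times> 'g"
    and f'' :: "real \<Rightarrow> 'x \<Rightarrow> real \<times> 'g \<Rightarrow> (real \<times> 'g) \<Rightarrow>\<^sub>L (real \<times> 'g)"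
    and g' :: "'x \<Rightarrow> real \<Rightarrow> real"
    and H :: "real set" and \<theta>\<^sub>0 \<alpha> lam hbar :: real and \<gamma> :: 'g
    and hhat :: "nat \<Rightarrow> (nat \<Rightarrow> real \<times> 'x) \<Rightarrow> real"
    and ghat :: "nat \<Rightarrow> (nat \<Rightarrow> real \<times> 'x) \<Rightarrow> 'g"
    and dflt :: "nat \<Rightarrow> (nat \<Rightarrow> real \<times> 'x) \<Rightarrow> real"
  assumes "0 < \<alpha>" and "\<alpha> < 1"
    and "\<theta>\<^sub>0 \<in> Theta_set m" and "\<gamma> \<in> Gamma_set m"
    and "lam = inverse (\<integral>x. dens m (bdry m x \<theta>\<^sub>0) x (\<theta>\<^sub>0, \<gamma>) * g' x \<theta>\<^sub>0 \<partial>X_law m)"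
    and "hbar = lam * ln (1 / \<alpha>)" and "hbar \<in> H"
    and "\<And>h. h \<in> H \<Longrightarrow> assumption_B m f' f'' g' H \<theta>\<^sub>0 \<gamma> hhat hbar ghat h"
    and "\<And>n. is_test m n (dflt n)"
  shows "AUMP m \<theta>\<^sub>0 \<gamma> \<alpha> {h \<in> H. h \<le> 0} {h \<in> H. h > 0} (phi_minus m \<theta>\<^sub>0 dflt hhat)"
proof -
  let ?\<phi> = "phi_minus m \<theta>\<^sub>0 dflt hhat"
  note \<alpha> = assms(1,2)
  have Bi: "assumption_B_i m H \<theta>\<^sub>0 \<gamma>" and Biii: "assumption_B_iii m f' f'' g' \<theta>\<^sub>0 \<gamma>"
    using assms(8)[OF assms(7)] by (auto simp: assumption_B_def)
  have Bii: "assumption_B_ii m \<theta>\<^sub>0 \<gamma> hhat hbar ghat h" if "h \<in> H" for h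
    using assms(8)[OF that] by (auto simp: assumption_B_def)
  obtain \<eta> C where "regular_boundary_path m \<gamma> \<theta>\<^sub>0 \<eta> C (\<lambda>y a \<theta>. fst (f' y a (\<theta>, \<gamma>))) g'"
    using assumption_B_regular_boundary_path[OF Bi Biii] by blast
  then interpret R: regular_boundary_path m \<gamma> \<theta>\<^sub>0 \<eta> C "\<lambda>y a \<theta>. fst (f' y a (\<theta>, \<gamma>))" g' .
  have hh: "hhat n \<in> borel_measurable (sample_space m n)" for n
    using Bii[OF assms(7)] by (simp add: assumption_B_ii_def)
  have \<Theta>: "Theta_set m \<in> sets borel"
  proof -
    have "convex (fst ` (Theta_set m \<times> Gamma_set m))"
      using Bi by (intro convex_linear_image linear_fst) (auto simp: assumption_B_i_def)
    also have "fst ` (Theta_set m \<times> Gamma_set m) = Theta_set m" using assms(4) by auto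
    finally show ?thesis by (simp add: is_interval_convex_1 real_interval_borel_measurable)
  qed
  have test: "is_test m n (?\<phi> n)" for n
  proof (rule phi_minus_is_test[OF R.finite_X \<Theta> _ hh assms(9)])
    show "continuous_on (Theta_set m) (bdry m a)" if "a \<in> Xset m" for a
      using Biii that unfolding assumption_B_iii_def by (blast intro: DERIV_continuous_on)
  qed
  have power: "(\<lambda>n. \<integral>z. ?\<phi> n z \<partial>local_law m \<theta>\<^sub>0 \<gamma> h n) \<longlonglongrightarrow> exp (- (R.rate * max 0 (hbar - h)))"
    if "h \<in> H" for h
    using Bii[OF that] by (intro R.phi_minus_power test hh) (simp add: assumption_B_ii_def)
  then have lim: "rejection_prob m \<theta>\<^sub>0 \<gamma> ?\<phi> h \<longlonglongrightarrow> ereal (exp (- (R.rate * max 0 (hbar - h))))" if "h \<in> H" for h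
    using that unfolding rejection_prob_def by (simp add: tendsto_ereal)
  have rh: "R.rate * hbar = ln (1 / \<alpha>)"
    using R.rate_pos assms(5,6) by (simp add: R.rate_eq)
  have hbar: "hbar > 0"
  proof -
    have "R.rate * hbar > 0" unfolding rh using \<alpha> by simp
    then show ?thesis using R.rate_pos by (simp add: zero_less_mult_iff)
  qed
  have size: "exp (- (R.rate * (hbar - h))) = exp (R.rate * h) * \<alpha>" for h
    using rh \<alpha> by (simp add: right_diff_distrib exp_diff exp_minus field_simps)
  have "limsup (rejection_prob m \<theta>\<^sub>0 \<gamma> ?\<phi> h) \<le> ereal \<alpha>" if "h \<in> H" "h \<le> 0" for h
  proof -
    have "exp (R.rate * h) \<le> 1" using R.rate_pos that by (simp add: mult_nonneg_nonpos)
    then have "exp (R.rate * h) * \<alpha> \<le> \<alpha>" using \<alpha> by simp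
    then show ?thesis
      using lim_imp_Limsup[OF _ lim[OF that(1)]] that hbar size[of h] by simp
  qed
  moreover have "limsup (rejection_prob m \<theta>\<^sub>0 \<gamma> \<psi> h) \<le> liminf (rejection_prob m \<theta>\<^sub>0 \<gamma> ?\<phi> h)"
    if \<psi>: "asymp_level m \<theta>\<^sub>0 \<gamma> \<alpha> {h \<in> H. h \<le> 0} \<psi>" and h: "h \<in> H" "h > 0" for \<psi> h
  proof -
    have \<psi>t: "is_test m n (\<psi> n)" for n using \<psi> by (simp add: asymp_level_def)
    have "0 \<in> H" using Bi by (simp add: assumption_B_i_def)
    then have env: "limsup (rejection_prob m \<theta>\<^sub>0 \<gamma> \<psi> h) \<le> ereal (exp (R.rate * h) * \<alpha>)"
      using \<psi> by (intro R.power_envelope[OF h(2) \<psi>t \<alpha>(2)]) (simp add: asymp_level_def)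
    have one: "limsup (rejection_prob m \<theta>\<^sub>0 \<gamma> \<psi> h) \<le> ereal 1"
      by (rule R.limsup_rejection_prob_le_1[OF \<psi>t])
    \<comment> \<open>For \<open>h \<le> hbar\<close> the test attains the Neyman-Pearson bound; beyond \<open>hbar\<close> its power tends to 1.\<close>
    have "limsup (rejection_prob m \<theta>\<^sub>0 \<gamma> \<psi> h) \<le> ereal (exp (- (R.rate * max 0 (hbar - h))))"
      using env one size[of h] by (cases "h \<le> hbar") (auto simp: max_def)
    also have "\<dots> = liminf (rejection_prob m \<theta>\<^sub>0 \<gamma> ?\<phi> h)"
      using lim_imp_Liminf[OF _ lim[OF h(1)]] by simp
    finally show ?thesis .
  qed
  ultimately show ?thesis
    using test by (auto simp: AUMP_def asymp_level_def)
qed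

end
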